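(* There is an absolute constant $C>0$ such that the following holds. Let $\mathcal{H}$ be a finite-dimensional Hilbert space, let $\mathcal{O}\in\mathcal{L}(\mathcal{H})$ be a known observable, let $k\geq 2$ be an integer and $\varepsilon>0$. There is a quantum algorithm that, using at most $C\, k\log(k)\,\|\mathcal{O}\|^2/\varepsilon^2$ samples of an unknown quantum state $\rho$ on $\mathcal{H}$ (i.e., $O(k\log(k)\|\mathcal{O}\|^2/\varepsilon^2)$ samples), outputs real numbers $\tilde p_1,\ldots,\tilde p_k$ such that with probability at least $2/3$, simultaneously for all $1\leq j\leq k$, $|\tilde p_j-\operatorname{tr}(\mathcal{O}\rho^j)|\leq\varepsilon$. Here $\|\mathcal{O}\|$ is the operator norm.
   Context: An observable is a Hermitian operator; $\mathcal{L}(\mathcal{H})$ is the set of linear operators on $\mathcal{H}$. A sample of $\rho$ is one copy of $\rho$, and the algorithm may perform arbitrary quantum operations and measurements on the copies. "Estimate to within additive error $\varepsilon$" means the output is $\varepsilon$-close to the true value with probability at least $2/3$ (here, all $k$ values are simultaneously $\varepsilon$-close with probability at least $2/3$). *)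

theory Defs
  imports Complex_Main "Jordan_Normal_Form.Matrix"
begin

text \<open>A d-dimensional Hilbert space is modelled as C^d; operators as d x d complex matrices.\<close>

definition hermitian_mat :: "nat \<Rightarrow> complex mat \<Rightarrow> bool" where
  "hermitian_mat d A \<longleftrightarrow> A \<in> carrier_mat d d \<and>
     (\<forall>i<d. \<forall>j<d. A $$ (i, j) = cnj (A $$ (j, i)))"

definition psd_mat :: "nat \<Rightarrow> complex mat \<Rightarrow> bool" where
  "psd_mat d A \<longleftrightarrow> hermitian_mat d A \<and>
     (\<forall>v \<in> carrier_vec d. 0 \<le> Re (\<Sum>i<d. \<Sum>j<d. cnj (v $ i) * A $$ (i, j) * v $ j))"

definition mtrace :: "complex mat \<Rightarrow> complex" where
  "mtrace A = (\<Sum>i<dim_row A. A $$ (i, i))"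

definition density_mat :: "nat \<Rightarrow> complex mat \<Rightarrow> bool" where
  "density_mat d \<rho> \<longleftrightarrow> psd_mat d \<rho> \<and> mtrace \<rho> = 1"

definition cvec_norm :: "complex vec \<Rightarrow> real" where
  "cvec_norm v = sqrt (\<Sum>i<dim_vec v. (cmod (v $ i))\<^sup>2)"

definition op_norm :: "nat \<Rightarrow> complex mat \<Rightarrow> real" where
  "op_norm d A = Sup {cvec_norm (A *\<^sub>v v) | v. v \<in> carrier_vec d \<and> cvec_norm v \<le> 1}"

definition kron :: "complex mat \<Rightarrow> complex mat \<Rightarrow> complex mat" where
  "kron A B = mat (dim_row A * dim_row B) (dim_col A * dim_col B)
     (\<lambda>(i, j). A $$ (i div dim_row B, j div dim_col B) * B $$ (i mod dim_row B, j mod dim_col B))"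

fun tensor_pow :: "complex mat \<Rightarrow> nat \<Rightarrow> complex mat" where
  "tensor_pow A 0 = 1\<^sub>m 1"
| "tensor_pow A (Suc m) = kron A (tensor_pow A m)"

definition povm :: "nat \<Rightarrow> 'a set \<Rightarrow> ('a \<Rightarrow> complex mat) \<Rightarrow> bool" where
  "povm D X E \<longleftrightarrow> finite X \<and> (\<forall>x\<in>X. psd_mat D (E x)) \<and> (\<forall>i<D. \<forall>j<D. (\<Sum>x\<in>X. E x $$ (i, j)) = (if i = j then 1 else 0))"

text \<open>Probability that measuring state sigma with POVM (X,E) yields an outcome satisfying P (Born rule).\<close>
definition outcome_prob :: "'a set \<Rightarrow> ('a \<Rightarrow> complex mat) \<Rightarrow> complex mat \<Rightarrow> ('a \<Rightarrow> bool) \<Rightarrow> real" where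
  "outcome_prob X E \<sigma> P = (\<Sum>x\<in>{x\<in>X. P x}. Re (mtrace (E x * \<sigma>)))"

end

theory Submission
  imports Defs
    "HOL-Library.Function_Algebras"
    "HOL-Computational_Algebra.Fundamental_Theorem_Algebra"
    "HOL-Combinatorics.Orbits"
    "HOL-Probability.Hoeffding"
    "HOL-Probability.Product_PMF"
    "HOL-Analysis.Harmonic_Numbers"
begin

text \<open>
  For \<open>j \<le> k\<close> let \<open>A\<^sub>j\<close> be the average over all permutations \<open>\<tau>\<close> of the \<open>k\<close> copies of the operator
  "shift copies \<open>1, \<dots>, j\<close> cyclically, then apply \<open>\<O>\<close> to copy \<open>1\<close>", conjugated by \<open>\<tau>\<close>. Then
  \<open>tr (A\<^sub>j \<rho>\<^sup>\<otimes>\<^sup>k) = tr (\<O> \<rho>\<^sup>j)\<close> and the norm of \<open>A\<^sub>j\<close> is at most that of \<open>\<O>\<close>. The point is that the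
  \<open>A\<^sub>j\<close> are Hermitian and commute: any permutation \<open>\<pi>\<close> is conjugated to its inverse by reflecting
  its cycles, and given two positions \<open>u, v\<close> the reflections can be centred so that \<open>{u, v}\<close> is sent
  to \<open>{\<pi>\<inverse> u, \<pi>\<inverse> v}\<close>. Hence an averaged word \<open>\<O>\<^sub>u \<O>\<^sub>v \<pi>\<close> equals its adjoint
  \<open>\<pi>\<inverse> \<O>\<^sub>v \<O>\<^sub>u\<close> averaged; every product \<open>A\<^sub>i A\<^sub>j\<close> is a combination of such words, hence Hermitian.

  So all \<open>A\<^sub>j\<close> can be measured jointly on one batch of \<open>k\<close> copies, giving unbiased estimators of all
  \<open>tr (\<O> \<rho>\<^sup>j)\<close> bounded by the norm of \<open>\<O>\<close>. Averaging over \<open>O(log k \<parallel>\<O>\<parallel>\<^sup>2 / \<epsilon>\<^sup>2)\<close> batches,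
  Hoeffding's inequality and a union bound over \<open>j\<close> give the claim. If \<open>\<parallel>\<O>\<parallel> \<le> \<epsilon>\<close>, the budget may
  force zero samples, but then the constant answer \<open>0\<close> is good enough.
\<close>

section \<open>Self-adjoint operators on finitely supported functions\<close>

text \<open>Estimating each moment on its own batch of \<open>j\<close> copies would cost about
  \<open>k\<^sup>2 / 2\<close> samples per round; one measurement serving all \<open>j\<close> costs
  \<open>k\<close>, so commutation is where the saving lies. The plain words "shift, then
  observable" are in general not self-adjoint for \<open>j \<ge> 2\<close> and do not commute;
  averaging over relabellings loses nothing, because a product of equal states is invariant under
  them.

  Commutation is read off from self-adjointness alone: \<open>A\<^sub>i A\<^sub>j\<close> equals its
  adjoint, which is \<open>A\<^sub>j A\<^sub>i\<close>. Two marked positions are just what this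
  tolerates. A reflection of a cycle has one free parameter, its centre; once it sends
  \<open>u\<close> to the predecessor of \<open>v\<close>, it sends \<open>v\<close> to the
  predecessor of \<open>u\<close>. Three marked positions on one cycle could not be matched in
  general.

  The outcomes are bounded by the operator norm whatever \<open>k\<close> is, so \<open>k\<close>
  enters the number of batches only through the union bound. Positivity is carried as a Gram form,
  which products over copies and batches preserve.\<close>

definition cscale :: "complex \<Rightarrow> ('i \<Rightarrow> complex) \<Rightarrow> 'i \<Rightarrow> complex" where
  "cscale c v = (\<lambda>i. c * v i)"

text \<open>Vectors indexed by \<Omega> are total functions vanishing off \<Omega>, so that equality
  of vectors is plain equality of functions.\<close>

definition supp_on :: "'i set \<Rightarrow> ('i \<Rightarrow> complex) set" where
  "supp_on \<Omega> = {v. \<forall>i. i \<notin> \<Omega> \<longrightarrow> v i = 0}"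

definition inner_on :: "'i set \<Rightarrow> ('i \<Rightarrow> complex) \<Rightarrow> ('i \<Rightarrow> complex) \<Rightarrow> complex" where
  "inner_on \<Omega> u v = (\<Sum>i\<in>\<Omega>. cnj (u i) * v i)"

definition linop :: "(('i \<Rightarrow> complex) \<Rightarrow> ('i \<Rightarrow> complex)) \<Rightarrow> bool" where
  "linop A \<longleftrightarrow> (\<forall>u v. A (u + v) = A u + A v) \<and> (\<forall>c v. A (cscale c v) = cscale c (A v))"

definition selfadj :: "'i set \<Rightarrow> (('i \<Rightarrow> complex) \<Rightarrow> ('i \<Rightarrow> complex)) \<Rightarrow> bool" where
  "selfadj \<Omega> A \<longleftrightarrow> linop A \<and> A ` supp_on \<Omega> \<subseteq> supp_on \<Omega> \<and>
     (\<forall>u\<in>supp_on \<Omega>. \<forall>v\<in>supp_on \<Omega>. inner_on \<Omega> u (A v) = inner_on \<Omega> (A u) v)"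

definition csubspace_fun :: "('i \<Rightarrow> complex) set \<Rightarrow> bool" where
  "csubspace_fun M \<longleftrightarrow> 0 \<in> M \<and> (\<forall>u\<in>M. \<forall>v\<in>M. u + v \<in> M) \<and> (\<forall>c. \<forall>v\<in>M. cscale c v \<in> M)"

lemma cscale_simps [simp]: "cscale c 0 = 0" "cscale 0 v = 0" "cscale 1 v = v" "cscale c (cscale c' v) = cscale (c * c') v"
  by (auto simp: cscale_def fun_eq_iff)

lemma cscale_add: "cscale c (u + v) = cscale c u + cscale c v"
  and cscale_diff: "cscale c (u - v) = cscale c u - cscale c v"
  and cscale_left_diff: "cscale (c - c') v = cscale c v - cscale c' v"
  by (auto simp: cscale_def fun_eq_iff algebra_simps)

lemma cscale_minus_one: "cscale (-1) v = - v"
  by (auto simp: cscale_def fun_eq_iff)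

lemma linop_add: "linop A \<Longrightarrow> A (u + v) = A u + A v"
  and linop_cscale: "linop A \<Longrightarrow> A (cscale c v) = cscale c (A v)"
  by (auto simp: linop_def)

lemma linop_diff: "linop A \<Longrightarrow> A (u - v) = A u - A v"
  using linop_add[of A "u - v" v] by (simp add: eq_diff_eq)

lemma linop_zero: "linop A \<Longrightarrow> A 0 = 0"
  using linop_cscale[of A 0 0] by simp

lemma linop_sum: "linop A \<Longrightarrow> A (sum w X) = (\<Sum>x\<in>X. A (w x))"
  by (induction X rule: infinite_finite_induct) (auto simp: linop_zero linop_add)

lemma linop_funpow: "linop A \<Longrightarrow> linop (A ^^ n)"
  by (induction n) (auto simp: linop_def)

lemma csubspace_funD:
  assumes "csubspace_fun M"
  shows "0 \<in> M" "u \<in> M \<Longrightarrow> v \<in> M \<Longrightarrow> u + v \<in> M" "u \<in> M \<Longrightarrow> cscale c u \<in> M"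
    "u \<in> M \<Longrightarrow> v \<in> M \<Longrightarrow> u - v \<in> M"
proof -
  show "0 \<in> M" "u \<in> M \<Longrightarrow> v \<in> M \<Longrightarrow> u + v \<in> M" "u \<in> M \<Longrightarrow> cscale c u \<in> M" for u v c
    using assms by (auto simp: csubspace_fun_def)
  from this(2)[of u "cscale (-1) v"] this(3)[of v "-1"]
  show "u \<in> M \<Longrightarrow> v \<in> M \<Longrightarrow> u - v \<in> M" by (simp add: cscale_minus_one)
qed

lemma csubspace_fun_sum_list:
  "csubspace_fun M \<Longrightarrow> set ws \<subseteq> M \<Longrightarrow> sum_list ws \<in> M"
  by (induction ws) (auto simp: csubspace_funD)

lemma csubspace_supp_on: "csubspace_fun (supp_on \<Omega>)"
  by (auto simp: csubspace_fun_def supp_on_def cscale_def)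

lemma inner_on_add_left: "inner_on \<Omega> (u + u') v = inner_on \<Omega> u v + inner_on \<Omega> u' v"
  and inner_on_add_right: "inner_on \<Omega> u (v + v') = inner_on \<Omega> u v + inner_on \<Omega> u v'"
  and inner_on_diff_left: "inner_on \<Omega> (u - u') v = inner_on \<Omega> u v - inner_on \<Omega> u' v"
  and inner_on_cscale_left: "inner_on \<Omega> (cscale c u) v = cnj c * inner_on \<Omega> u v"
  and inner_on_cscale_right: "inner_on \<Omega> u (cscale c v) = c * inner_on \<Omega> u v"
  by (auto simp: inner_on_def cscale_def algebra_simps sum.distrib sum_subtractf sum_distrib_left)

lemma inner_on_self: "inner_on \<Omega> v v = of_real (\<Sum>i\<in>\<Omega>. (cmod (v i))\<^sup>2)"
  unfolding inner_on_def of_real_sum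
  by (intro sum.cong refl) (metis complex_norm_square mult.commute)

lemma inner_on_self_zero:
  assumes "finite \<Omega>" "v \<in> supp_on \<Omega>" "inner_on \<Omega> v v = 0"
  shows "v = 0"
proof -
  have "(\<Sum>i\<in>\<Omega>. (cmod (v i))\<^sup>2) = 0"
    using assms(3) unfolding inner_on_self by (simp only: of_real_eq_0_iff)
  then have "\<forall>i\<in>\<Omega>. v i = 0"
    using assms(1) by (simp add: sum_nonneg_eq_0_iff)
  then show ?thesis
    using assms(2) by (auto simp: supp_on_def fun_eq_iff)
qed

text \<open>Gaussian elimination, one coordinate at a time: a vector with nonzero entry at
  \<open>x\<close> is the pivot, and its coefficient is solved for after the induction hypothesis
  has treated the others.\<close>

lemma linear_dependence:
  fixes v :: "'a \<Rightarrow> 'i \<Rightarrow> complex"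
  assumes "finite \<Omega>" "finite I" "card \<Omega> < card I"
  shows "\<exists>c. (\<exists>i\<in>I. c i \<noteq> 0) \<and> (\<forall>x\<in>\<Omega>. (\<Sum>i\<in>I. c i * v i x) = 0)"
  using assms
proof (induction \<Omega> arbitrary: I v rule: finite_induct)
  case empty
  then obtain i where "i \<in> I" by fastforce
  then show ?case by (intro exI[of _ "\<lambda>_. 1"]) auto
next
  case (insert x \<Omega>)
  show ?case
  proof (cases "\<forall>i\<in>I. v i x = 0")
    case True
    have "card \<Omega> < card I" using insert.prems insert.hyps by simp
    from insert.IH[OF insert.prems(1) this, of v] True show ?thesis
      by (auto simp: sum.neutral)
  next
    case False
    then obtain a where a: "a \<in> I" "v a x \<noteq> 0" by blast
    define v' where "v' = (\<lambda>i y. v i y - v i x / v a x * v a y)"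
    have "card \<Omega> < card (I - {a})" using insert a by simp
    from insert.IH[OF _ this, of v'] insert.prems obtain c i where
      c: "i \<in> I - {a}" "c i \<noteq> 0" and cz: "\<forall>y\<in>\<Omega>. (\<Sum>i\<in>I-{a}. c i * v' i y) = 0"
      by auto
    define c' where "c' = c(a := - (\<Sum>i\<in>I-{a}. c i * v i x) / v a x)"
    have eq: "(\<Sum>i\<in>I. c' i * v i y) = (\<Sum>i\<in>I-{a}. c i * v' i y)" for y
    proof -
      have "(\<Sum>i\<in>I. c' i * v i y) = c' a * v a y + (\<Sum>i\<in>I-{a}. c' i * v i y)"
        using insert.prems a by (simp add: sum.remove)
      also have "(\<Sum>i\<in>I-{a}. c' i * v i y) = (\<Sum>i\<in>I-{a}. c i * v i y)"
        by (intro sum.cong) (auto simp: c'_def)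
      also have "c' a * v a y = (\<Sum>i\<in>I-{a}. - (c i * v i x / v a x * v a y))"
        by (simp add: c'_def sum_divide_distrib sum_distrib_right sum_negf)
      finally show ?thesis
        by (simp add: v'_def algebra_simps sum.distrib[symmetric] sum_subtractf)
    qed
    have "(\<Sum>i\<in>I-{a}. c i * v' i x) = 0"
      using a by (intro sum.neutral) (auto simp: v'_def)
    then have "\<forall>y\<in>insert x \<Omega>. (\<Sum>i\<in>I. c' i * v i y) = 0"
      using cz unfolding eq by auto
    moreover have "c' i \<noteq> 0" "i \<in> I" using c by (auto simp: c'_def)
    ultimately show ?thesis by blast
  qed
qed

section \<open>Eigenvector decompositions from annihilating polynomials\<close>

definition poly_op :: "complex poly \<Rightarrow> (('i \<Rightarrow> complex) \<Rightarrow> ('i \<Rightarrow> complex)) \<Rightarrow> ('i \<Rightarrow> complex) \<Rightarrow> 'i \<Rightarrow> complex" where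
  "poly_op p A v = (\<lambda>x. \<Sum>i\<le>degree p. coeff p i * (A ^^ i) v x)"

lemma poly_op_altdef:
  assumes "degree p \<le> n"
  shows "poly_op p A v = (\<lambda>x. \<Sum>i\<le>n. coeff p i * (A ^^ i) v x)"
proof
  fix x show "poly_op p A v x = (\<Sum>i\<le>n. coeff p i * (A ^^ i) v x)"
    unfolding poly_op_def using assms
    by (intro sum.mono_neutral_left) (auto simp: coeff_eq_0)
qed

text \<open>Moves the factor \<open>A - z\<close> innermost, so that removing a root replaces
  \<open>v\<close> by \<open>A v - z v\<close>, a vector of the same invariant subspaces.\<close>

lemma poly_op_linear_factor:
  assumes A: "linop A"
  shows "poly_op ([:- z, 1:] * q) A v = poly_op q A (A v - cscale z v)"
proof
  fix x
  let ?p = "[:- z, 1:] * q"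
  have dp: "degree ?p \<le> Suc (degree q)"
    using degree_mult_le[of "[:- z, 1:]" q] by simp
  have pw: "(A ^^ i) (A v - cscale z v) x = (A ^^ Suc i) v x - z * (A ^^ i) v x" for i
    using linop_funpow[OF A, of i]
    by (simp only: linop_diff linop_cscale funpow_Suc_right o_apply) (simp add: cscale_def)
  have p: "?p = pCons 0 q - smult z q" by simp
  have "poly_op ?p A v x = (\<Sum>i\<le>Suc (degree q). coeff ?p i * (A ^^ i) v x)"
    by (simp only: poly_op_altdef[OF dp])
  also have "\<dots> = (\<Sum>i\<le>Suc (degree q). coeff (pCons 0 q) i * (A ^^ i) v x)
      - (\<Sum>i\<le>Suc (degree q). z * coeff q i * (A ^^ i) v x)"
    unfolding p coeff_diff by (simp add: sum_subtractf algebra_simps)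
  also have "(\<Sum>i\<le>Suc (degree q). coeff (pCons 0 q) i * (A ^^ i) v x)
      = (\<Sum>i\<le>degree q. coeff q i * (A ^^ Suc i) v x)"
    by (subst sum.atMost_Suc_shift) simp
  also have "(\<Sum>i\<le>Suc (degree q). z * coeff q i * (A ^^ i) v x)
      = (\<Sum>i\<le>degree q. z * coeff q i * (A ^^ i) v x)"
    by (simp add: coeff_eq_0)
  finally show "poly_op ?p A v x = poly_op q A (A v - cscale z v) x"
    unfolding poly_op_def pw by (simp add: sum_subtractf algebra_simps)
qed

text \<open>Peeling off one root at a time: self-adjointness forces the roots to be real and kills
  generalised eigenvectors.\<close>

lemma eigen_decomposition_poly:
  assumes "finite \<Omega>" and A: "selfadj \<Omega> A" and M: "csubspace_fun M" "M \<subseteq> supp_on \<Omega>" "A ` M \<subseteq> M"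
  shows "p \<noteq> 0 \<Longrightarrow> v \<in> M \<Longrightarrow> poly_op p A v = 0 \<Longrightarrow>
    \<exists>ws. v = sum_list ws \<and> (\<forall>w\<in>set ws. w \<in> M \<and> (\<exists>\<mu>::real. A w = cscale \<mu> w))"
proof (induction "degree p" arbitrary: p v)
  case 0
  then obtain c where c: "p = [:c:]" "c \<noteq> 0" by (metis degree_eq_zeroE pCons_0_0)
  have "v = 0" using 0 c by (auto simp: poly_op_def fun_eq_iff)
  then show ?case by (intro exI[of _ "[]"]) auto
next
  case (Suc n)
  have lin: "linop A" using A by (simp add: selfadj_def)
  obtain z where "poly p z = 0"
    using fundamental_theorem_of_algebra_alt[of p] Suc by (metis constant_degree fundamental_theorem_of_algebra nat.distinct(1))
  then obtain q where q: "p = [:- z, 1:] * q" by (metis dvdE poly_eq_0_iff_dvd)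
  have q0: "q \<noteq> 0" using Suc q by auto
  have "degree p = Suc (degree q)" unfolding q using q0 by (subst degree_mult_eq) auto
  then have dq: "n = degree q" using Suc by simp
  define Y where "Y = A v - cscale z v"
  have "Y \<in> M" using Suc.prems M by (auto simp: Y_def intro!: csubspace_funD)
  moreover have "poly_op q A Y = 0"
    using Suc.prems(3) unfolding q poly_op_linear_factor[OF lin] Y_def .
  ultimately obtain ws where ws: "Y = sum_list ws"
      "\<forall>w\<in>set ws. w \<in> M \<and> (\<exists>\<mu>::real. A w = cscale \<mu> w)"
    using Suc.hyps(1)[OF dq q0] by blast
  then obtain m :: "('a \<Rightarrow> complex) \<Rightarrow> real" where m: "\<forall>w\<in>set ws. A w = cscale (m w) w"
    by metis
  \<comment> \<open>Dividing by \<open>m w - z\<close> inverts \<open>A - z\<close> on every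
    eigenvector whose eigenvalue differs from \<open>z\<close>. Once these preimages are subtracted
    from \<open>v\<close>, the remainder satisfies \<open>(A - z) R = Z\<close> with
    \<open>A Z = z Z\<close>.\<close>
  define us where "us = map (\<lambda>w. cscale (1 / (m w - z)) w) (filter (\<lambda>w. of_real (m w) \<noteq> z) ws)"
  define zs where "zs = filter (\<lambda>w. of_real (m w) = z) ws"
  define R where "R = v - sum_list us"
  define Z where "Z = sum_list zs"
  have us: "w \<in> M \<and> (\<exists>\<mu>::real. A w = cscale \<mu> w)" if "w \<in> set us" for w
    using that ws m M by (auto simp: us_def linop_cscale[OF lin] mult.commute intro!: csubspace_funD)
  have RM: "R \<in> M" unfolding R_def
    using Suc.prems us M by (auto intro!: csubspace_funD csubspace_fun_sum_list)
  have ZM: "Z \<in> M" unfolding Z_def zs_def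
    using ws M by (auto intro!: csubspace_fun_sum_list)
  have "A (sum_list us) - cscale z (sum_list us) = sum_list (filter (\<lambda>w. of_real (m w) \<noteq> z) ws)"
    unfolding us_def using m
  proof (induction ws)
    case (Cons w ws)
    have inv: "cscale (m w * (1 / (m w - z))) w - cscale (z * (1 / (m w - z))) w = w"
      if "of_real (m w) \<noteq> z"
      using that unfolding cscale_left_diff[symmetric] left_diff_distrib[symmetric] by simp
    show ?case
    proof (cases "of_real (m w) = z")
      case False
      let ?S = "sum_list (map (\<lambda>w. cscale (1 / (m w - z)) w) (filter (\<lambda>w. of_real (m w) \<noteq> z) ws))"
      have "A (cscale (1 / (m w - z)) w + ?S) - cscale z (cscale (1 / (m w - z)) w + ?S)
          = (cscale (m w * (1 / (m w - z))) w - cscale (z * (1 / (m w - z))) w) + (A ?S - cscale z ?S)"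
        using Cons.prems
        by (simp add: linop_add[OF lin] linop_cscale[OF lin] cscale_add algebra_simps)
      also have "\<dots> = w + sum_list (filter (\<lambda>w. of_real (m w) \<noteq> z) ws)"
      proof -
        have IH: "A ?S - cscale z ?S = sum_list (filter (\<lambda>w. of_real (m w) \<noteq> z) ws)"
          by (rule Cons.IH) (use Cons.prems in auto)
        show ?thesis by (simp only: IH inv[OF False])
      qed
      finally show ?thesis using False
        by (simp only: filter.simps if_True if_False list.map sum_list.Cons not_False_eq_True simp_thms)
    qed (use Cons in simp)
  qed (auto simp: linop_zero[OF lin])
  moreover have "sum_list ws = sum_list (filter (\<lambda>w. of_real (m w) \<noteq> z) ws) + sum_list zs"
    unfolding zs_def by (induction ws) (auto simp: algebra_simps)
  ultimately have AR: "A R - cscale z R = Z"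
    using ws(1) unfolding R_def Z_def Y_def
    by (simp add: linop_diff[OF lin] cscale_diff algebra_simps)
  have AZ: "A Z = cscale z Z"
    unfolding Z_def zs_def using m
    by (induction ws) (auto simp: linop_zero[OF lin] linop_add[OF lin] cscale_add)
  have sa: "inner_on \<Omega> u (A w) = inner_on \<Omega> (A u) w" if "u \<in> M" "w \<in> M" for u w
    using A subsetD[OF M(2) that(1)] subsetD[OF M(2) that(2)] unfolding selfadj_def by (metis (no_types))
  \<comment> \<open>For real \<open>z\<close>, the vector \<open>Z\<close> lies in both the range
    and the kernel of \<open>A - z\<close>, so it is orthogonal to itself. For non-real
    \<open>z\<close> no summand has eigenvalue \<open>z\<close>, hence \<open>Z = 0\<close> and
    \<open>R\<close> would be an eigenvector with non-real eigenvalue, which forces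
    \<open>R = 0\<close>.\<close>
  have "A R = cscale z R \<and> (z \<in> \<real> \<or> R = 0)"
  proof (cases "z \<in> \<real>")
    case True
    then have "cnj z = z" by (simp add: Reals_cnj_iff)
    then have "inner_on \<Omega> Z Z = inner_on \<Omega> R (A Z) - z * inner_on \<Omega> R Z"
      unfolding sa[OF RM ZM] by (simp add: AR[symmetric] inner_on_diff_left inner_on_cscale_left)
    then have "inner_on \<Omega> Z Z = 0" unfolding AZ by (simp add: inner_on_cscale_right)
    then have "Z = 0" using inner_on_self_zero assms ZM by blast
    then show ?thesis using AR True by simp
  next
    case False
    then have "zs = []" by (auto simp: zs_def filter_empty_conv)
    then have "A R = cscale z R" using AR by (simp add: Z_def)
    with sa[OF RM RM] have "(z - cnj z) * inner_on \<Omega> R R = 0"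
      by (simp add: inner_on_cscale_left inner_on_cscale_right algebra_simps)
    then have "inner_on \<Omega> R R = 0" using False by (auto simp: Reals_cnj_iff)
    then have "R = 0" using inner_on_self_zero assms RM by blast
    then show ?thesis using linop_zero[OF lin] by simp
  qed
  then have "\<exists>\<mu>::real. A R = cscale \<mu> R"
    using linop_zero[OF lin] by (auto simp: Reals_def)
  moreover have "v = sum_list (R # us)" by (simp add: R_def)
  ultimately show ?case using us RM by (intro exI[of _ "R # us"]) auto
qed

text \<open>The vectors \<open>(A ^^ i) v\<close> with \<open>i \<le> card \<Omega>\<close> are too
  many to be independent, and a dependence is an annihilating polynomial for \<open>v\<close>. The
  subspace \<open>M\<close> is carried along so that a decomposition can be refined inside an
  eigenspace of other operators.\<close>

lemma eigen_decomposition: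
  assumes "finite \<Omega>" and A: "selfadj \<Omega> A" and M: "csubspace_fun M" "M \<subseteq> supp_on \<Omega>" "A ` M \<subseteq> M"
    and v: "v \<in> M"
  shows "\<exists>ws. v = sum_list ws \<and> (\<forall>w\<in>set ws. w \<in> M \<and> (\<exists>\<mu>::real. A w = cscale \<mu> w))"
proof -
  let ?N = "card \<Omega>"
  from linear_dependence[of \<Omega> "{..?N}" "\<lambda>i. (A ^^ i) v"] assms(1)
  obtain c i where c: "i \<le> ?N" "c i \<noteq> 0" and cz: "\<forall>x\<in>\<Omega>. (\<Sum>i\<le>?N. c i * (A ^^ i) v x) = 0"
    by auto
  define p where "p = (\<Sum>i\<le>?N. monom (c i) i)"
  have cp: "coeff p i = (if i \<le> ?N then c i else 0)" for i
    by (simp add: p_def coeff_sum)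
  have "p \<noteq> 0" using c cp[of i] by auto
  have dp: "degree p \<le> ?N" by (rule degree_le) (auto simp: cp)
  have AM: "(A ^^ i) v \<in> M" for i
    using v M by (induction i) auto
  have "(A ^^ i) v x = 0" if "x \<notin> \<Omega>" for x i
    using AM[of i] that M by (auto simp: supp_on_def)
  then have "poly_op p A v = 0"
    using cz by (auto simp: poly_op_altdef[OF dp] fun_eq_iff cp)
  with eigen_decomposition_poly[OF assms(1-5) \<open>p \<noteq> 0\<close> v] show ?thesis by blast
qed

text \<open>A summand obtained for the first \<open>n\<close> operators lies in a joint eigenspace;
  commutation makes that space invariant under the next operator, so the summand splits further
  within it.\<close>

lemma joint_eigen_decomposition:
  fixes A :: "nat \<Rightarrow> ('i \<Rightarrow> complex) \<Rightarrow> ('i \<Rightarrow> complex)"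
  assumes "finite \<Omega>" "\<And>j. j < n \<Longrightarrow> selfadj \<Omega> (A j)"
    and comm: "\<And>i j v. i < n \<Longrightarrow> j < n \<Longrightarrow> v \<in> supp_on \<Omega> \<Longrightarrow> A i (A j v) = A j (A i v)"
    and "v \<in> supp_on \<Omega>"
  shows "\<exists>ws. v = sum_list ws \<and> (\<forall>w\<in>set ws. w \<in> supp_on \<Omega> \<and> (\<forall>j<n. \<exists>\<mu>::real. A j w = cscale \<mu> w))"
  using assms(2-)
proof (induction n)
  case 0
  then show ?case by (intro exI[of _ "[v]"]) auto
next
  case (Suc n)
  then obtain ws where ws: "v = sum_list ws"
    "\<forall>w\<in>set ws. w \<in> supp_on \<Omega> \<and> (\<forall>j<n. \<exists>\<mu>::real. A j w = cscale \<mu> w)"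
    by (metis less_SucI)
  have step: "\<exists>us. w = sum_list us \<and> (\<forall>u\<in>set us. u \<in> supp_on \<Omega> \<and> (\<forall>j<Suc n. \<exists>\<mu>::real. A j u = cscale \<mu> u))"
    if w: "w \<in> set ws" for w
  proof -
    obtain x :: "nat \<Rightarrow> real" where x: "\<forall>j<n. A j w = cscale (x j) w"
      using ws w by metis
    define M where "M = {u \<in> supp_on \<Omega>. \<forall>j<n. A j u = cscale (x j) u}"
    have lin: "linop (A j)" if "j < Suc n" for j using Suc.prems(1)[OF that] by (simp add: selfadj_def)
    have "csubspace_fun M"
      using csubspace_supp_on[of \<Omega>] lin
      by (auto simp: M_def csubspace_fun_def linop_zero linop_add linop_cscale cscale_add mult.commute)
    moreover have "A n ` M \<subseteq> M"
    proof
      fix u assume "u \<in> A n ` M"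
      then obtain t where t: "u = A n t" "t \<in> M" by blast
      have "A j u = cscale (x j) u" if "j < n" for j
        using t that Suc.prems(2)[of j n t] linop_cscale[OF lin[of n]] by (auto simp: M_def)
      moreover have "u \<in> supp_on \<Omega>" using t Suc.prems(1)[of n] by (auto simp: M_def selfadj_def)
      ultimately show "u \<in> M" by (simp add: M_def)
    qed
    moreover have "w \<in> M" using ws w x by (auto simp: M_def)
    ultimately obtain us where us: "w = sum_list us" "\<forall>u\<in>set us. u \<in> M \<and> (\<exists>\<mu>::real. A n u = cscale \<mu> u)"
      using eigen_decomposition[OF assms(1) Suc.prems(1)[of n], of M w] by (auto simp: M_def)
    then show ?thesis
      by (intro exI[of _ us]) (auto simp: M_def less_Suc_eq)
  qed
  then obtain U where U: "\<forall>w\<in>set ws. w = sum_list (U w) \<and>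
      (\<forall>u\<in>set (U w). u \<in> supp_on \<Omega> \<and> (\<forall>j<Suc n. \<exists>\<mu>::real. A j u = cscale \<mu> u))"
    by metis
  have "sum_list ws = sum_list (concat (map U ws))"
    using U by (induction ws) auto
  then show ?case using ws(1) U by (intro exI[of _ "concat (map U ws)"]) auto
qed

section \<open>Spectral projections of a commuting family\<close>

lemma selfadjD:
  "selfadj \<Omega> A \<Longrightarrow> u \<in> supp_on \<Omega> \<Longrightarrow> v \<in> supp_on \<Omega> \<Longrightarrow> inner_on \<Omega> u (A v) = inner_on \<Omega> (A u) v"
  by (simp add: selfadj_def)

text \<open>Tuples are padded with zeros from \<open>n\<close> on, so that distinct tuples differ at
  an index where some operator separates them.\<close>

definition joint_eig ::
  "'i set \<Rightarrow> nat \<Rightarrow> (nat \<Rightarrow> ('i \<Rightarrow> complex) \<Rightarrow> 'i \<Rightarrow> complex) \<Rightarrow> (nat \<Rightarrow> real) \<Rightarrow> ('i \<Rightarrow> complex) \<Rightarrow> bool" where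
  "joint_eig \<Omega> n A x w \<longleftrightarrow>
     w \<in> supp_on \<Omega> \<and> (\<forall>j<n. A j w = cscale (complex_of_real (x j)) w) \<and> (\<forall>j\<ge>n. x j = 0)"

lemma csubspace_joint_eig:
  assumes "\<And>j. j < n \<Longrightarrow> linop (A j)" "\<forall>j\<ge>n. x j = 0"
  shows "csubspace_fun {w. joint_eig \<Omega> n A x w}"
  using csubspace_supp_on[of \<Omega>] assms
  by (auto simp: joint_eig_def csubspace_fun_def linop_zero linop_add linop_cscale cscale_add mult.commute)

text \<open>\<open>P x\<close> is the matrix of the orthogonal projection onto the joint eigenspace
  of \<open>x\<close>; its column \<open>g\<close> collects the summands with tuple \<open>x\<close>
  in a decomposition of the basis vector at \<open>g\<close>. The fourth property says
  \<open>P = P\<^sup>* P\<close>; this form yields positivity and survives products of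
  effects.\<close>

lemma joint_spectral_measure:
  fixes A :: "nat \<Rightarrow> ('i \<Rightarrow> complex) \<Rightarrow> ('i \<Rightarrow> complex)"
  assumes fin: "finite \<Omega>" and sa: "\<And>j. j < n \<Longrightarrow> selfadj \<Omega> (A j)"
    and comm: "\<And>i j v. i < n \<Longrightarrow> j < n \<Longrightarrow> v \<in> supp_on \<Omega> \<Longrightarrow> A i (A j v) = A j (A i v)"
  obtains X :: "(nat \<Rightarrow> real) set" and P where
    "finite X"
    "\<And>x. x \<in> X \<Longrightarrow> \<exists>v\<in>supp_on \<Omega>. v \<noteq> 0 \<and> (\<forall>j<n. A j v = cscale (x j) v)"
    "\<And>f g. f \<in> \<Omega> \<Longrightarrow> g \<in> \<Omega> \<Longrightarrow> (\<Sum>x\<in>X. P x f g) = (if f = g then 1 else 0)"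
    "\<And>x f g. x \<in> X \<Longrightarrow> f \<in> \<Omega> \<Longrightarrow> g \<in> \<Omega> \<Longrightarrow> P x f g = (\<Sum>h\<in>\<Omega>. cnj (P x h f) * P x h g)"
    "\<And>x g. x \<in> X \<Longrightarrow> g \<in> \<Omega> \<Longrightarrow> (\<lambda>f. P x f g) \<in> supp_on \<Omega>"
    "\<And>x g j. x \<in> X \<Longrightarrow> g \<in> \<Omega> \<Longrightarrow> j < n \<Longrightarrow> A j (\<lambda>f. P x f g) = cscale (x j) (\<lambda>f. P x f g)"
proof -
  define \<delta> :: "'i \<Rightarrow> 'i \<Rightarrow> complex" where "\<delta> = (\<lambda>g f. if f = g then 1 else 0)"
  let ?eig = "joint_eig \<Omega> n A"
  have lin: "linop (A j)" if "j < n" for j using sa[OF that] by (simp add: selfadj_def)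
  have "\<exists>ws. \<delta> g = sum_list ws \<and> (\<forall>w\<in>set ws. \<exists>x. ?eig x w)" if "g \<in> \<Omega>" for g
  proof -
    have "\<delta> g \<in> supp_on \<Omega>" using that by (auto simp: supp_on_def \<delta>_def)
    from joint_eigen_decomposition[of \<Omega> n A, OF fin sa comm this] obtain ws where
      ws: "\<delta> g = sum_list ws" "\<forall>w\<in>set ws. w \<in> supp_on \<Omega> \<and> (\<forall>j<n. \<exists>\<mu>::real. A j w = cscale \<mu> w)" by blast
    have "\<exists>x. ?eig x w" if "w \<in> set ws" for w
    proof -
      have "\<forall>j<n. \<exists>m::real. A j w = cscale m w" using bspec[OF ws(2) that] by (rule conjunct2)
      then have "A j w = cscale (complex_of_real (SOME m. A j w = cscale (complex_of_real m) w)) w" if "j < n" for j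
        using that by (metis (mono_tags, lifting) someI_ex)
      then show ?thesis using ws(2) that
        by (intro exI[of _ "\<lambda>j. if j < n then SOME m. A j w = cscale (complex_of_real m) w else 0"]) (auto simp: joint_eig_def)
    qed
    then show ?thesis using ws by blast
  qed
  then obtain W where W: "\<And>g. g \<in> \<Omega> \<Longrightarrow> \<delta> g = sum_list (W g)"
    "\<And>g. g \<in> \<Omega> \<Longrightarrow> \<forall>w\<in>set (W g). \<exists>x. ?eig x w" by (metis (no_types, lifting))
  define \<xi> where "\<xi> = (\<lambda>w. SOME x. ?eig x w)"
  have \<xi>: "?eig (\<xi> w) w" if "g \<in> \<Omega>" "w \<in> set (W g)" for g w
    unfolding \<xi>_def by (rule someI_ex[where P = "\<lambda>x. ?eig x w"]) (use W(2)[OF that(1)] that(2) in blast)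
  \<comment> \<open>A zero vector is an eigenvector for every tuple. Dropping zero summands gives
    each tuple in \<open>X\<close> a nonzero eigenvector, which is what later bounds the
    outcomes.\<close>
  define X where "X = \<xi> ` (\<Union>g\<in>\<Omega>. {w \<in> set (W g). w \<noteq> 0})"
  define F where "F = (\<lambda>x g. filter (\<lambda>w. w \<noteq> 0 \<and> \<xi> w = x) (W g))"
  define P where "P = (\<lambda>x f g. sum_list (F x g) f)"
  have Xeig: "?eig x w" if "g \<in> \<Omega>" "w \<in> set (F x g)" for x g w
    using \<xi>[OF that(1)] that(2) by (auto simp: F_def)
  have Xout: "\<forall>j\<ge>n. x j = 0" if "x \<in> X" for x
    using that \<xi> by (auto simp: X_def joint_eig_def)
  have Peig: "?eig x (\<lambda>f. P x f g)" if "x \<in> X" "g \<in> \<Omega>" for x g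
  proof -
    have "sum_list (F x g) \<in> {w. ?eig x w}"
      using Xeig[OF that(2)] Xout[OF that(1)] lin
      by (intro csubspace_fun_sum_list csubspace_joint_eig) auto
    then show ?thesis by (simp add: P_def)
  qed
  have sumX: "(\<Sum>x\<in>X. P x f g) = \<delta> g f" if g: "g \<in> \<Omega>" for f g
  proof -
    have fX: "finite X" unfolding X_def using fin by auto
    have "(\<Sum>x\<in>X. sum_list (filter (\<lambda>w. w \<noteq> 0 \<and> \<xi> w = x) ws) f) = sum_list ws f"
      if "\<xi> ` {w \<in> set ws. w \<noteq> 0} \<subseteq> X" for ws
      using that
    proof (induction ws)
      case (Cons w ws)
      have IH: "(\<Sum>x\<in>X. sum_list (filter (\<lambda>w. w \<noteq> 0 \<and> \<xi> w = x) ws) f) = sum_list ws f"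
        by (rule Cons.IH) (use Cons.prems in auto)
      have "(\<Sum>x\<in>X. sum_list (filter (\<lambda>w. w \<noteq> 0 \<and> \<xi> w = x) (w # ws)) f) =
          (\<Sum>x\<in>X. (if \<xi> w = x then w f else 0) + sum_list (filter (\<lambda>w. w \<noteq> 0 \<and> \<xi> w = x) ws) f)"
        by (intro sum.cong) auto
      also have "\<dots> = (if \<xi> w \<in> X then w f else 0) + sum_list ws f"
        using fX by (simp add: sum.distrib IH)
      also have "\<dots> = sum_list (w # ws) f"
        using Cons.prems by (cases "w = 0") auto
      finally show ?case .
    qed simp
    from this[of "W g"] show ?thesis using W(1)[OF g] g by (auto simp: P_def F_def X_def)
  qed
  have orth: "inner_on \<Omega> (\<lambda>h. P x h f) (\<lambda>h. P y h g) = 0"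
    if "x \<in> X" "y \<in> X" "x \<noteq> y" "f \<in> \<Omega>" "g \<in> \<Omega>" for x y f g
  proof -
    let ?u = "\<lambda>h. P x h f" and ?v = "\<lambda>h. P y h g"
    have e: "?eig x ?u" "?eig y ?v" using Peig that by auto
    obtain j where j: "x j \<noteq> y j" using ext[of x y] \<open>x \<noteq> y\<close> by blast
    then have "j < n" using Xout that by (metis not_le)
    then have "inner_on \<Omega> ?u (A j ?v) = inner_on \<Omega> (A j ?u) ?v"
      using e by (intro selfadjD[OF sa]) (simp_all only: joint_eig_def)
    then have "of_real (y j) * inner_on \<Omega> ?u ?v = of_real (x j) * inner_on \<Omega> ?u ?v"
      using e \<open>j < n\<close> by (simp add: joint_eig_def inner_on_cscale_left inner_on_cscale_right)
    then show ?thesis using j by simp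
  qed
  txt \<open>Orthogonality of the eigenspaces and \<open>\<Sum>\<^sub>y P\<^sub>y = 1\<close> give \<open>P\<^sub>x\<^sup>* = P\<^sub>x\<^sup>* P\<^sub>x\<close>, whose right-hand side is
    self-adjoint.\<close>
  have gram: "P x f g = (\<Sum>h\<in>\<Omega>. cnj (P x h f) * P x h g)" if x: "x \<in> X" and fg: "f \<in> \<Omega>" "g \<in> \<Omega>" for x f g
  proof -
    have fX: "finite X" unfolding X_def using fin by auto
    have key: "cnj (P x g f) = inner_on \<Omega> (\<lambda>h. P x h f) (\<lambda>h. P x h g)" if fg: "f \<in> \<Omega>" "g \<in> \<Omega>" for f g
    proof -
      have "cnj (P x g f) = (\<Sum>h\<in>\<Omega>. cnj (P x h f) * \<delta> g h)"
        using fin fg by (simp add: \<delta>_def if_distrib cong: if_cong)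
      also have "\<dots> = (\<Sum>h\<in>\<Omega>. \<Sum>y\<in>X. cnj (P x h f) * P y h g)"
        using fg by (intro sum.cong refl) (simp add: sumX[symmetric] sum_distrib_left)
      also have "\<dots> = (\<Sum>y\<in>X. inner_on \<Omega> (\<lambda>h. P x h f) (\<lambda>h. P y h g))"
        unfolding inner_on_def by (rule sum.swap)
      also have "\<dots> = (\<Sum>y\<in>X. if y = x then inner_on \<Omega> (\<lambda>h. P x h f) (\<lambda>h. P y h g) else 0)"
        using orth x fg by (intro sum.cong) auto
      finally show ?thesis using fX x by simp
    qed
    have "P x f g = cnj (inner_on \<Omega> (\<lambda>h. P x h g) (\<lambda>h. P x h f))"
      using key[OF fg(2,1)] by (metis complex_cnj_cnj)
    also have "\<dots> = inner_on \<Omega> (\<lambda>h. P x h f) (\<lambda>h. P x h g)"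
      by (simp add: inner_on_def cnj_sum mult.commute)
    finally show ?thesis by (simp add: inner_on_def)
  qed
  show thesis
  proof (rule that[of X P])
    show "finite X" unfolding X_def using fin by auto
    show "\<exists>v\<in>supp_on \<Omega>. v \<noteq> 0 \<and> (\<forall>j<n. A j v = cscale (x j) v)" if "x \<in> X" for x
      using that \<xi> by (fastforce simp: X_def joint_eig_def)
    show "(\<Sum>x\<in>X. P x f g) = (if f = g then 1 else 0)" if "f \<in> \<Omega>" "g \<in> \<Omega>" for f g
      using sumX[OF that(2)] by (simp add: \<delta>_def)
    show "P x f g = (\<Sum>h\<in>\<Omega>. cnj (P x h f) * P x h g)" if "x \<in> X" "f \<in> \<Omega>" "g \<in> \<Omega>" for x f g
      using gram that by blast
    show "(\<lambda>f. P x f g) \<in> supp_on \<Omega>" if "x \<in> X" "g \<in> \<Omega>" for x g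
      using Peig[OF that] by (simp add: joint_eig_def)
    show "A j (\<lambda>f. P x f g) = cscale (x j) (\<lambda>f. P x f g)" if "x \<in> X" "g \<in> \<Omega>" "j < n" for x g j
      using Peig[OF that(1,2)] that(3) by (simp add: joint_eig_def)
  qed
qed

section \<open>Reflections of the cycles of a permutation\<close>

text \<open>The token \<open>inv\<close> is taken by the group inverse of HOL-Algebra.\<close>

abbreviation finv :: "('a \<Rightarrow> 'a) \<Rightarrow> 'a \<Rightarrow> 'a" where
  "finv \<equiv> inv_into UNIV"

text \<open>The hypothesis says that the cycle length divides the difference of \<open>s\<close> and
  \<open>t\<close>, a condition shared by all points of the cycle and by the inverse permutation.
  Hence a map on a cycle may be defined by counting steps.\<close>

lemma funpow_inv_eq_on_orbit:
  assumes p: "permutation p" and eq: "(p ^^ s) r = (p ^^ t) r" and b: "b \<in> orbit p r"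
  shows "(finv p ^^ s) b = (finv p ^^ t) b"
  using eq
proof (induction s t rule: linorder_wlog)
  case (le s t)
  have bij: "bij p" using p by (rule permutation_bijective)
  have inj: "inj (p ^^ i)" for i using bij by (simp add: bij_is_inj inj_fn)
  have inv_pow: "(finv p ^^ i) ((p ^^ i) z) = z" for i z
    using inj[of i] by (simp add: inv_fn[OF bij, symmetric])
  define k where "k = t - s"
  have t: "t = s + k" using le by (simp add: k_def)
  have "(p ^^ s) r = (p ^^ s) ((p ^^ k) r)" using le(2) unfolding t by (simp add: funpow_add)
  then have r: "(p ^^ k) r = r" using inj[of s] by (metis injD)
  obtain j where j: "b = (p ^^ j) r" using b p by (auto simp: orbit_altdef_permutation)
  have "(p ^^ k) b = b" unfolding j
    by (metis r add.commute comp_apply funpow_add)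
  then have "(finv p ^^ k) b = b" using inv_pow[of k b] by simp
  then show ?case unfolding t by (simp add: funpow_add)
qed simp

text \<open>On each cycle the conjugating permutation is a reflection; on the cycle (or cycles) of
  \<open>u\<close> and \<open>v\<close> its centre is prescribed, elsewhere it is arbitrary.\<close>

lemma permutation_conj_inverse:
  fixes p :: "'a \<Rightarrow> 'a"
  assumes p: "p permutes S" and "finite S"
  obtains \<tau> where "\<tau> permutes S" "\<And>x. \<tau> (p x) = finv p (\<tau> x)"
    "\<tau> u = finv p u \<and> \<tau> v = finv p v \<or> \<tau> u = finv p v \<and> \<tau> v = finv p u"
proof -
  have perm: "permutation p" using assms permutation_permutes by blast
  \<comment> \<open>\<open>R C\<close> is a base point of the cycle \<open>C\<close> and
    \<open>B C\<close> its prescribed image: the reflection sends \<open>(p ^^ n) (R C)\<close> to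
    \<open>(finv p ^^ n) (B C)\<close>. The step count \<open>t x\<close> is an arbitrary choice,
    harmless by the previous lemma.\<close>
  define R where "R = (\<lambda>C. if u \<in> C then u else if v \<in> C then v else SOME y. y \<in> C)"
  \<comment> \<open>If \<open>u\<close> and \<open>v\<close> share a cycle, \<open>u\<close> is sent
    to \<open>finv p v\<close>; writing \<open>v = (p ^^ n) u\<close>, its image is
    \<open>finv p\<close> applied to \<open>(finv p ^^ n) v = u\<close>, the swapped alternative. On
    separate cycles each point is sent to its own predecessor.\<close>
  define B where "B = (\<lambda>C. if u \<in> C then (if v \<in> C then finv p v else finv p u)
      else if v \<in> C then finv p v else R C)"
  define t where "t = (\<lambda>x. SOME t. (p ^^ t) (R (orbit p x)) = x)"
  define \<tau> where "\<tau> = (\<lambda>x. (finv p ^^ t x) (B (orbit p x)))"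
  have self: "x \<in> orbit p x" for x using perm by (rule permutation_self_in_orbit)
  have R: "R (orbit p x) \<in> orbit p x" for x
    using self[of x] by (auto simp: R_def intro: someI)
  have sym: "y \<in> orbit p x" if "x \<in> orbit p y" for x y
    using orbit_swap[OF self that] .
  have orb_eq: "orbit p y = orbit p x" if "y \<in> orbit p x" for x y
    using that sym by (auto intro: orbit_trans)
  have orb_inv: "finv p y \<in> orbit p x" if "y \<in> orbit p x" for x y
    using that perm by (metis orbit.base orbit_inv_eq orbit_trans)
  have orb_invn: "(finv p ^^ n) y \<in> orbit p x" if "y \<in> orbit p x" for x y n
    using that by (induction n) (auto intro: orb_inv)
  have B: "B (orbit p x) \<in> orbit p x" for x
    using R[of x] by (auto simp: B_def intro: orb_inv)
  have t: "(p ^^ t x) (R (orbit p x)) = x" for x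
  proof -
    have "x \<in> orbit p (R (orbit p x))" using R sym by blast
    then obtain n where "x = (p ^^ n) (R (orbit p x))"
      unfolding orbit_altdef_permutation[OF perm, of "R (orbit p x)"] by blast
    then have "\<exists>t. (p ^^ t) (R (orbit p x)) = x" by metis
    then show ?thesis unfolding t_def by (rule someI_ex)
  qed
  have tau_pow: "\<tau> ((p ^^ n) (R (orbit p x))) = (finv p ^^ n) (B (orbit p x))" for n x
  proof -
    let ?y = "(p ^^ n) (R (orbit p x))"
    have o: "orbit p ?y = orbit p x" using R by (intro orb_eq funpow_in_orbit)
    have "B (orbit p x) \<in> orbit p (R (orbit p x))" using B R orb_eq by metis
    then show ?thesis
      unfolding \<tau>_def o using t[of ?y] unfolding o
      by (intro funpow_inv_eq_on_orbit[OF perm]) auto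
  qed
  have tau_p: "\<tau> (p x) = finv p (\<tau> x)" for x
    using tau_pow[of "Suc (t x)" x] by (simp add: t \<tau>_def)
  have tau_pn: "\<tau> ((p ^^ n) x) = (finv p ^^ n) (\<tau> x)" for n x
    by (induction n) (auto simp: tau_p)
  have tau_orb: "\<tau> x \<in> orbit p x" for x
    unfolding \<tau>_def using B by (rule orb_invn)
  \<comment> \<open>If \<open>\<tau> x = \<tau> y\<close>, both points lie on one cycle and
    \<open>y = (p ^^ n) x\<close>, where \<open>n\<close> inverse steps fix \<open>\<tau> x\<close>.
    Then \<open>n\<close> steps fix every point of that cycle, in particular
    \<open>x\<close>.\<close>
  have "inj \<tau>"
  proof (rule injI)
    fix x y assume xy: "\<tau> x = \<tau> y"
    then have "y \<in> orbit p x" using tau_orb sym by (metis orbit_trans)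
    then obtain n where n: "y = (p ^^ n) x" using perm by (auto simp: orbit_altdef_permutation)
    then have eq: "(finv p ^^ n) (\<tau> x) = (finv p ^^ 0) (\<tau> x)" using tau_pn xy by simp
    have "orbit (finv p) (\<tau> x) = orbit p x" using orbit_inv_eq[OF perm] tau_orb orb_eq by metis
    then have "x \<in> orbit (finv p) (\<tau> x)" using self by simp
    then have "(finv (finv p) ^^ n) x = (finv (finv p) ^^ 0) x"
      using perm by (intro funpow_inv_eq_on_orbit[OF _ eq]) (auto intro: permutation_inverse)
    then show "x = y" using n perm by (simp add: inv_inv_eq permutation_bijective)
  qed
  moreover have "\<tau> x \<in> S" if "x \<in> S" for x
    using permutes_orbit_subset[OF p that] tau_orb by auto
  moreover have "\<tau> x = x" if "x \<notin> S" for x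
  proof -
    have "p x = x" using p that by (simp add: permutes_not_in)
    then have "(p ^^ n) x = x" for n by (induction n) auto
    then have "orbit p x = {x}" by (auto simp: orbit_altdef)
    then show ?thesis using tau_orb[of x] by simp
  qed
  ultimately have "\<tau> permutes S"
    using \<open>finite S\<close> by (intro inj_imp_permutes) (auto intro: inj_on_subset)
  moreover have tR: "\<tau> (R (orbit p x)) = B (orbit p x)" for x
    using tau_pow[of 0 x] by simp
  have "\<tau> u = finv p u \<and> \<tau> v = finv p v \<or> \<tau> u = finv p v \<and> \<tau> v = finv p u"
  proof (cases "v \<in> orbit p u")
    case True
    then obtain n where n: "v = (p ^^ n) u" using perm by (auto simp: orbit_altdef_permutation)
    have "\<tau> u = finv p v" using tR[of u] True self by (simp add: R_def B_def)
    moreover have "(finv p ^^ n) v = u"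
      using n permutation_bijective[OF perm]
      by (simp add: inv_fn[symmetric] inj_fn bij_is_inj)
    then have "\<tau> v = finv p u"
      unfolding n tau_pn \<open>\<tau> u = finv p v\<close> by (metis funpow_swap1 n)
    ultimately show ?thesis by simp
  next
    case False
    then have "u \<notin> orbit p v" using sym by blast
    then show ?thesis using tR[of u] tR[of v] False self by (simp add: R_def B_def)
  qed
  ultimately show thesis using that tau_p by blast
qed

section \<open>Permutation operators and local operators on a tensor power\<close>

text \<open>Product basis vectors of the \<open>k\<close>-fold tensor power: \<open>f t\<close> is the index in factor \<open>t\<close>.\<close>

definition configs :: "nat \<Rightarrow> nat \<Rightarrow> (nat \<Rightarrow> nat) set" where
  "configs d k = {f. (\<forall>t<k. f t < d) \<and> (\<forall>t\<ge>k. f t = 0)}"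

lemma configs_0 [simp]: "configs d 0 = {\<lambda>_. 0}"
  by (auto simp: configs_def)

lemma sum_configs_Suc:
  "(\<Sum>f\<in>configs d (Suc k). F f) = (\<Sum>f\<in>configs d k. \<Sum>a<d. F (f(k := a)))"
  unfolding sum.cartesian_product
  by (rule sum.reindex_bij_witness[of _ "\<lambda>(f, a). f(k := a)" "\<lambda>f. (f(k := 0), f k)"])
     (auto simp: configs_def fun_eq_iff less_Suc_eq le_Suc_eq)

lemma configs_Suc: "configs d (Suc k) = (\<lambda>(f, a). f(k := a)) ` (configs d k \<times> {..<d})"
proof -
  have "f \<in> (\<lambda>(f, a). f(k := a)) ` (configs d k \<times> {..<d})" if "f \<in> configs d (Suc k)" for f
    using that by (intro image_eqI[of _ _ "(f(k := 0), f k)"]) (auto simp: configs_def)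
  then show ?thesis by (auto simp: configs_def less_Suc_eq)
qed

lemma finite_configs [simp]: "finite (configs d k)"
  by (induction k) (auto simp: configs_Suc)

lemma sum_configs_prod:
  fixes h :: "nat \<Rightarrow> nat \<Rightarrow> 'a :: comm_semiring_1"
  shows "(\<Sum>f\<in>configs d k. \<Prod>t<k. h t (f t)) = (\<Prod>t<k. \<Sum>a<d. h t a)"
proof (induction k)
  case (Suc k)
  have "(\<Sum>f\<in>configs d (Suc k). \<Prod>t<Suc k. h t (f t))
      = (\<Sum>f\<in>configs d k. \<Sum>a<d. (\<Prod>t<k. h t (f t)) * h k a)"
    unfolding sum_configs_Suc
  proof (intro sum.cong refl)
    fix f a
    have "(\<Prod>t<k. h t ((f(k := a)) t)) = (\<Prod>t<k. h t (f t))" by (intro prod.cong) auto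
    then show "(\<Prod>t<Suc k. h t ((f(k := a)) t)) = (\<Prod>t<k. h t (f t)) * h k a" by simp
  qed
  also have "\<dots> = (\<Sum>f\<in>configs d k. \<Prod>t<k. h t (f t)) * (\<Sum>a<d. h k a)"
    by (simp add: sum_product)
  finally show ?case using Suc by simp
qed simp

lemma configs_comp_iff:
  assumes "p permutes {..<k}"
  shows "f \<circ> p \<in> configs d k \<longleftrightarrow> f \<in> configs d k"
proof -
  have "(\<forall>t<k. f (p t) < d) \<longleftrightarrow> (\<forall>t<k. f t < d)"
    using permutes_image[OF assms] by (metis (no_types, lifting) assms lessThan_iff permutes_def permutes_in_image)
  moreover have "p t = t" if "t \<ge> k" for t
    using permutes_not_in[OF assms] that by simp
  ultimately show ?thesis by (auto simp: configs_def)
qed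

lemma configs_upd_iff:
  assumes "u < k" "f u < d" "b < d"
  shows "f(u := b) \<in> configs d k \<longleftrightarrow> f \<in> configs d k"
  using assms by (auto simp: configs_def)

lemma sum_configs_comp:
  assumes "p permutes {..<k}"
  shows "(\<Sum>f\<in>configs d k. F (f \<circ> p)) = (\<Sum>f\<in>configs d k. F f)"
proof (rule sum.reindex_bij_witness[of _ "\<lambda>f. f \<circ> finv p" "\<lambda>f. f \<circ> p"])
  have q: "finv p permutes {..<k}" using assms by (rule permutes_inv)
  show "f \<circ> p \<circ> finv p = f" "f \<circ> finv p \<circ> p = f" for f :: "nat \<Rightarrow> nat"
    using permutes_inv_o[OF assms] by (simp_all add: o_assoc[symmetric])
  show "f \<circ> p \<in> configs d k" "f \<circ> finv p \<in> configs d k" if "f \<in> configs d k" for f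
    using that by (auto simp: configs_comp_iff[OF assms] configs_comp_iff[OF q])
qed auto

text \<open>Exchanging the entry at \<open>u\<close> with the free index is an involution on pairs.
  It transposes an operator acting on factor \<open>u\<close>; for a summand independent of
  \<open>b\<close> it is an averaging identity.\<close>

lemma sum_configs_exchange:
  assumes "u < k"
  shows "(\<Sum>f\<in>configs d k. \<Sum>b<d. F f b) = (\<Sum>f\<in>configs d k. \<Sum>b<d. F (f(u := b)) (f u))"
  unfolding sum.cartesian_product
  using assms
  by (intro sum.reindex_bij_witness[of _ "\<lambda>(f, b). (f(u := b), f u)" "\<lambda>(f, b). (f(u := b), f u)"])
     (auto simp: configs_def)

text \<open>Precomposition with \<open>p\<close> itself rather than its inverse makes
  \<open>p \<mapsto> permop p\<close> a homomorphism, and conjugation by it carries an operator on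
  factor \<open>u\<close> to factor \<open>p u\<close>.\<close>

definition permop :: "(nat \<Rightarrow> nat) \<Rightarrow> ((nat \<Rightarrow> nat) \<Rightarrow> complex) \<Rightarrow> (nat \<Rightarrow> nat) \<Rightarrow> complex" where
  "permop p \<psi> = (\<lambda>f. \<psi> (f \<circ> p))"

text \<open>The guard preserves supports: if \<open>f u\<close> is out of range, \<open>f\<close> is
  no configuration although \<open>f(u := b)\<close> may be one.\<close>

definition locop :: "nat \<Rightarrow> complex mat \<Rightarrow> nat \<Rightarrow> ((nat \<Rightarrow> nat) \<Rightarrow> complex) \<Rightarrow> (nat \<Rightarrow> nat) \<Rightarrow> complex" where
  "locop d Q u \<psi> = (\<lambda>f. if f u < d then \<Sum>b<d. Q $$ (f u, b) * \<psi> (f(u := b)) else 0)"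

lemma linop_permop: "linop (permop p)"
  by (auto simp: linop_def permop_def cscale_def fun_eq_iff)

lemma linop_locop: "linop (locop d Q u)"
  by (auto simp: linop_def locop_def cscale_def fun_eq_iff sum.distrib sum_distrib_left algebra_simps)

lemma linop_comp: "linop A \<Longrightarrow> linop B \<Longrightarrow> linop (\<lambda>v. A (B v))"
  by (simp add: linop_def)

lemma permop_supp:
  "p permutes {..<k} \<Longrightarrow> \<psi> \<in> supp_on (configs d k) \<Longrightarrow> permop p \<psi> \<in> supp_on (configs d k)"
  by (auto simp: supp_on_def permop_def configs_comp_iff)

lemma locop_supp:
  "u < k \<Longrightarrow> \<psi> \<in> supp_on (configs d k) \<Longrightarrow> locop d Q u \<psi> \<in> supp_on (configs d k)"
  by (auto simp: supp_on_def locop_def configs_upd_iff)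

lemma permop_permop: "permop p (permop q \<psi>) = permop (p \<circ> q) \<psi>"
  by (simp add: permop_def o_assoc)

lemma permop_locop:
  assumes "inj p"
  shows "permop p (locop d Q u \<psi>) = locop d Q (p u) (permop p \<psi>)"
proof -
  have "(f \<circ> p)(u := b) = f(p u := b) \<circ> p" for f :: "nat \<Rightarrow> nat" and b
    using assms by (auto simp: fun_eq_iff inj_eq)
  then show ?thesis by (simp add: permop_def locop_def cong: if_cong)
qed

lemma locop_commute: "locop d Q u (locop d Q v \<psi>) = locop d Q v (locop d Q u \<psi>)"
proof (cases "u = v")
  case False
  show ?thesis
  proof
    fix f
    have "(\<Sum>b<d. \<Sum>c<d. Q $$ (f u, b) * (Q $$ (f v, c) * \<psi> (f(u := b, v := c))))
        = (\<Sum>c<d. \<Sum>b<d. Q $$ (f v, c) * (Q $$ (f u, b) * \<psi> (f(v := c, u := b))))"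
      using False by (subst sum.swap) (simp add: fun_upd_twist mult.left_commute)
    with False show "locop d Q u (locop d Q v \<psi>) f = locop d Q v (locop d Q u \<psi>) f"
      by (auto simp: locop_def sum_distrib_left)
  qed
qed simp

section \<open>Averaging over the symmetric group\<close>

definition twirl :: "nat \<Rightarrow> (((nat \<Rightarrow> nat) \<Rightarrow> complex) \<Rightarrow> (nat \<Rightarrow> nat) \<Rightarrow> complex) \<Rightarrow>
    ((nat \<Rightarrow> nat) \<Rightarrow> complex) \<Rightarrow> (nat \<Rightarrow> nat) \<Rightarrow> complex" where
  "twirl k G \<psi> = cscale (1 / fact k) (\<Sum>\<tau> | \<tau> permutes {..<k}. permop \<tau> (G (permop (finv \<tau>) \<psi>)))"

lemma finite_perms [simp]: "finite {\<tau>. \<tau> permutes {..<k::nat}}"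
  by (simp add: finite_permutations)

lemma cscale_sum: "cscale c (\<Sum>x\<in>X. w x) = (\<Sum>x\<in>X. cscale c (w x))"
  by (induction X rule: infinite_finite_induct)
     (simp_all only: sum.infinite sum.empty sum.insert cscale_simps cscale_add not_False_eq_True)

lemma linop_twirl:
  assumes "linop G"
  shows "linop (twirl k G)"
  unfolding linop_def[of "twirl k G"] twirl_def
  by (simp only: linop_add[OF assms] linop_cscale[OF assms] linop_add[OF linop_permop] linop_cscale[OF linop_permop]
      cscale_add sum.distrib cscale_sum cscale_simps mult.commute) simp

lemma sum_fun_supp: "(\<And>x. x \<in> X \<Longrightarrow> w x \<in> supp_on \<Omega>) \<Longrightarrow> sum w X \<in> supp_on \<Omega>"
  by (induction X rule: infinite_finite_induct)
     (auto intro: csubspace_funD[OF csubspace_supp_on])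

lemma twirl_supp:
  assumes "\<And>\<psi>. \<psi> \<in> supp_on (configs d k) \<Longrightarrow> G \<psi> \<in> supp_on (configs d k)" "\<psi> \<in> supp_on (configs d k)"
  shows "twirl k G \<psi> \<in> supp_on (configs d k)"
  unfolding twirl_def using assms
  by (intro csubspace_funD(3)[OF csubspace_supp_on] sum_fun_supp) (auto intro!: permop_supp permutes_inv)

lemma sum_permutations_comp_right:
  assumes "\<sigma> permutes S"
  shows "(\<Sum>\<tau> | \<tau> permutes S. F (\<tau> \<circ> \<sigma>)) = (\<Sum>\<tau> | \<tau> permutes S. F \<tau>)"
  using sum.reindex_bij_witness[of "{\<tau>. \<tau> permutes S}" "\<lambda>\<tau>. \<tau> \<circ> finv \<sigma>" "\<lambda>\<tau>. \<tau> \<circ> \<sigma>" "{\<tau>. \<tau> permutes S}" F "\<lambda>\<tau>. F (\<tau> \<circ> \<sigma>)"]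
  using assms permutes_inv_o[OF assms]
  by (auto simp: o_assoc[symmetric] permutes_compose permutes_inv)

lemma sum_permutations_comp_left:
  assumes "\<sigma> permutes S"
  shows "(\<Sum>\<tau> | \<tau> permutes S. F (\<sigma> \<circ> \<tau>)) = (\<Sum>\<tau> | \<tau> permutes S. F \<tau>)"
  using sum.reindex_bij_witness[of "{\<tau>. \<tau> permutes S}" "\<lambda>\<tau>. finv \<sigma> \<circ> \<tau>" "\<lambda>\<tau>. \<sigma> \<circ> \<tau>" "{\<tau>. \<tau> permutes S}" F "\<lambda>\<tau>. F (\<sigma> \<circ> \<tau>)"]
  using assms permutes_inv_o[OF assms]
  by (auto simp: o_assoc permutes_compose permutes_inv)

lemma finv_comp:
  assumes "\<tau> permutes S" "\<sigma> permutes S"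
  shows "finv (\<tau> \<circ> \<sigma>) = finv \<sigma> \<circ> finv \<tau>"
  using assms by (simp add: o_inv_distrib permutes_bij)

text \<open>Right translation permutes the symmetric group, so conjugate words have the same
  average. This turns a conjugation of permutations into an identity between averaged
  operators.\<close>

lemma twirl_conj:
  assumes "\<sigma> permutes {..<k}"
  shows "twirl k (\<lambda>\<psi>. permop \<sigma> (G (permop (finv \<sigma>) \<psi>))) = twirl k G"
proof
  fix \<psi>
  have "twirl k (\<lambda>\<psi>. permop \<sigma> (G (permop (finv \<sigma>) \<psi>))) \<psi> =
    cscale (1 / fact k) (\<Sum>\<tau> | \<tau> permutes {..<k}. permop (\<tau> \<circ> \<sigma>) (G (permop (finv (\<tau> \<circ> \<sigma>)) \<psi>)))"
    unfolding twirl_def using assms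
    by (intro arg_cong[where f = "cscale _"] sum.cong refl) (auto simp: permop_permop finv_comp)
  also have "\<dots> = twirl k G \<psi>"
    unfolding twirl_def
    using sum_permutations_comp_right[OF assms, of "\<lambda>\<tau>. permop \<tau> (G (permop (finv \<tau>) \<psi>))"] by simp
  finally show "twirl k (\<lambda>\<psi>. permop \<sigma> (G (permop (finv \<sigma>) \<psi>))) \<psi> = twirl k G \<psi>" .
qed

text \<open>Substituting \<open>\<tau> \<circ> \<sigma>\<close> for the second permutation leaves a
  common outer conjugation by \<tau>. A product of two averages thus becomes an average, over the
  relative permutation \<sigma>, of twirled single words.\<close>

lemma twirl_comp:
  assumes "linop G"
  shows "twirl k G (twirl k H \<psi>) =
    cscale (1 / fact k) (\<Sum>\<sigma> | \<sigma> permutes {..<k}. twirl k (\<lambda>\<psi>. G (permop \<sigma> (H (permop (finv \<sigma>) \<psi>)))) \<psi>)"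
proof -
  let ?P = "{\<tau>. \<tau> permutes {..<k}}"
  let ?K = "\<lambda>\<tau> \<sigma>. permop \<tau> (G (permop \<sigma> (H (permop (finv \<sigma>) (permop (finv \<tau>) \<psi>)))))"
  have "twirl k G (twirl k H \<psi>) = cscale (1 / fact k) (\<Sum>\<tau>\<in>?P. cscale (1 / fact k)
      (\<Sum>\<sigma>\<in>?P. permop \<tau> (G (permop (finv \<tau>) (permop \<sigma> (H (permop (finv \<sigma>) \<psi>)))))))"
    unfolding twirl_def
    by (simp only: linop_cscale[OF linop_permop] linop_cscale[OF assms] linop_sum[OF linop_permop] linop_sum[OF assms])
  also have "\<dots> = cscale (1 / fact k) (\<Sum>\<tau>\<in>?P. cscale (1 / fact k) (\<Sum>\<sigma>\<in>?P. ?K \<tau> \<sigma>))"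
  proof (rule arg_cong[where f = "cscale _"], rule sum.cong[OF refl], rule arg_cong[where f = "cscale _"])
    fix \<tau> assume "\<tau> \<in> ?P"
    then have \<tau>: "\<tau> permutes {..<k}" by simp
    have "(\<Sum>\<sigma>\<in>?P. permop \<tau> (G (permop (finv \<tau>) (permop \<sigma> (H (permop (finv \<sigma>) \<psi>))))))
      = (\<Sum>\<sigma>\<in>?P. permop \<tau> (G (permop (finv \<tau>) (permop (\<tau> \<circ> \<sigma>) (H (permop (finv (\<tau> \<circ> \<sigma>)) \<psi>))))))"
      by (rule sum_permutations_comp_left[OF \<tau>, symmetric])
    also have "\<dots> = (\<Sum>\<sigma>\<in>?P. ?K \<tau> \<sigma>)"
    proof (intro sum.cong refl)
      fix \<sigma> assume "\<sigma> \<in> ?P"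
      then have \<sigma>: "\<sigma> permutes {..<k}" by simp
      show "permop \<tau> (G (permop (finv \<tau>) (permop (\<tau> \<circ> \<sigma>) (H (permop (finv (\<tau> \<circ> \<sigma>)) \<psi>))))) = ?K \<tau> \<sigma>"
        using permutes_inv_o[OF \<tau>] by (simp add: permop_permop finv_comp[OF \<tau> \<sigma>] o_assoc)
    qed
    finally show "(\<Sum>\<sigma>\<in>?P. permop \<tau> (G (permop (finv \<tau>) (permop \<sigma> (H (permop (finv \<sigma>) \<psi>))))))
      = (\<Sum>\<sigma>\<in>?P. ?K \<tau> \<sigma>)" .
  qed
  also have "\<dots> = cscale (1 / fact k) (\<Sum>\<sigma>\<in>?P. cscale (1 / fact k) (\<Sum>\<tau>\<in>?P. ?K \<tau> \<sigma>))"
    by (subst cscale_sum[symmetric], subst sum.swap) (simp add: cscale_sum)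
  finally show ?thesis unfolding twirl_def .
qed

section \<open>Adjoints of permutation operators, local operators and averages\<close>

definition adjoint_on where
  "adjoint_on \<Omega> A B \<longleftrightarrow> (\<forall>u\<in>supp_on \<Omega>. \<forall>v\<in>supp_on \<Omega>. inner_on \<Omega> u (A v) = inner_on \<Omega> (B u) v)"

lemma adjoint_on_permop:
  assumes "p permutes {..<k}"
  shows "adjoint_on (configs d k) (permop p) (permop (finv p))"
proof -
  have "(\<Sum>f\<in>configs d k. cnj (u f) * v (f \<circ> p)) = (\<Sum>f\<in>configs d k. cnj (u (f \<circ> finv p)) * v f)" for u v :: "(nat \<Rightarrow> nat) \<Rightarrow> complex"
    using sum_configs_comp[OF assms, of "\<lambda>f. cnj (u (f \<circ> finv p)) * v f" d] permutes_inv_o[OF assms]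
    by (simp add: o_assoc[symmetric])
  then show ?thesis by (simp add: adjoint_on_def inner_on_def permop_def)
qed

lemma hermitian_matD:
  "hermitian_mat d A \<Longrightarrow> i < d \<Longrightarrow> j < d \<Longrightarrow> A $$ (i, j) = cnj (A $$ (j, i))"
  unfolding hermitian_mat_def by blast

lemma adjoint_on_locop:
  assumes "hermitian_mat d Q" "u < k"
  shows "adjoint_on (configs d k) (locop d Q u) (locop d Q u)"
proof -
  have "(\<Sum>f\<in>configs d k. \<Sum>b<d. cnj (\<phi> f) * (Q $$ (f u, b) * \<psi> (f(u := b))))
      = (\<Sum>f\<in>configs d k. \<Sum>b<d. cnj (Q $$ (f u, b) * \<phi> (f(u := b))) * \<psi> f)" for \<phi> \<psi> :: "(nat \<Rightarrow> nat) \<Rightarrow> complex"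
  proof (subst sum_configs_exchange[OF assms(2)], intro sum.cong refl)
    fix f b assume "f \<in> configs d k" "b \<in> {..<d}"
    then have "Q $$ (b, f u) = cnj (Q $$ (f u, b))"
      using assms(2) by (intro hermitian_matD[OF assms(1)]) (auto simp: configs_def)
    then show "cnj (\<phi> (f(u := b))) * (Q $$ ((f(u := b)) u, f u) * \<psi> (f(u := b, u := f u)))
      = cnj (Q $$ (f u, b) * \<phi> (f(u := b))) * \<psi> f" by simp
  qed
  moreover have "inner_on (configs d k) \<phi> (locop d Q u \<psi>) =
      (\<Sum>f\<in>configs d k. \<Sum>b<d. cnj (\<phi> f) * (Q $$ (f u, b) * \<psi> (f(u := b))))" for \<phi> \<psi>
    unfolding inner_on_def using assms(2)
    by (intro sum.cong refl) (simp add: locop_def configs_def sum_distrib_left)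
  moreover have "inner_on (configs d k) (locop d Q u \<phi>) \<psi> =
      (\<Sum>f\<in>configs d k. \<Sum>b<d. cnj (Q $$ (f u, b) * \<phi> (f(u := b))) * \<psi> f)" for \<phi> \<psi>
    unfolding inner_on_def using assms(2)
    by (intro sum.cong refl) (simp add: locop_def configs_def sum_distrib_right)
  ultimately show ?thesis by (simp only: adjoint_on_def) simp
qed

lemma adjoint_on_comp:
  assumes "adjoint_on \<Omega> A A'" "adjoint_on \<Omega> B B'" "B ` supp_on \<Omega> \<subseteq> supp_on \<Omega>" "A' ` supp_on \<Omega> \<subseteq> supp_on \<Omega>"
  shows "adjoint_on \<Omega> (\<lambda>v. A (B v)) (\<lambda>v. B' (A' v))"
  using assms by (simp add: adjoint_on_def image_subset_iff)

lemma inner_on_zero [simp]: "inner_on \<Omega> u 0 = 0" "inner_on \<Omega> 0 u = 0"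
  by (simp_all add: inner_on_def)

lemma inner_on_sum_right: "inner_on \<Omega> u (\<Sum>x\<in>X. w x) = (\<Sum>x\<in>X. inner_on \<Omega> u (w x))"
  by (induction X rule: infinite_finite_induct) 
     (simp_all only: sum.infinite sum.empty sum.insert inner_on_zero inner_on_add_right not_False_eq_True)

lemma inner_on_sum_left: "inner_on \<Omega> (\<Sum>x\<in>X. w x) u = (\<Sum>x\<in>X. inner_on \<Omega> (w x) u)"
  by (induction X rule: infinite_finite_induct) 
     (simp_all only: sum.infinite sum.empty sum.insert inner_on_zero inner_on_add_left not_False_eq_True)

lemma adjoint_on_twirl:
  assumes G: "adjoint_on (configs d k) G G'"
    "G ` supp_on (configs d k) \<subseteq> supp_on (configs d k)" "G' ` supp_on (configs d k) \<subseteq> supp_on (configs d k)"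
  shows "adjoint_on (configs d k) (twirl k G) (twirl k G')"
proof -
  let ?S = "supp_on (configs d k)"
  have "inner_on (configs d k) u (permop \<tau> (G (permop (finv \<tau>) v))) = inner_on (configs d k) (permop \<tau> (G' (permop (finv \<tau>) u))) v"
    if \<tau>: "\<tau> permutes {..<k}" and uv: "u \<in> ?S" "v \<in> ?S" for \<tau> u v
  proof -
    have \<tau>': "finv \<tau> permutes {..<k}" using \<tau> by (rule permutes_inv)
    have "finv (finv \<tau>) = \<tau>" using \<tau> by (rule permutes_inv_inv)
    then have 1: "adjoint_on (configs d k) (permop (finv \<tau>)) (permop \<tau>)"
      using adjoint_on_permop[OF \<tau>'] by simp
    have "adjoint_on (configs d k) (\<lambda>v. permop \<tau> (G (permop (finv \<tau>) v))) (\<lambda>v. permop \<tau> (G' (permop (finv \<tau>) v)))"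
      using adjoint_on_comp[OF adjoint_on_comp[OF adjoint_on_permop[OF \<tau>] G(1)] 1] permop_supp[OF \<tau>] permop_supp[OF \<tau>'] G
      by (auto simp: image_subset_iff)
    then show ?thesis using uv by (simp add: adjoint_on_def)
  qed
  then show ?thesis
    by (simp add: adjoint_on_def twirl_def inner_on_cscale_left inner_on_cscale_right inner_on_sum_left inner_on_sum_right)
qed

lemma selfadj_iff: "selfadj \<Omega> A \<longleftrightarrow> linop A \<and> A ` supp_on \<Omega> \<subseteq> supp_on \<Omega> \<and> adjoint_on \<Omega> A A"
  by (simp add: selfadj_def adjoint_on_def)

text \<open>The adjoint of \<open>A B\<close> is \<open>B A\<close>. Lacking adjoints as operators,
  the proof pairs the commutator applied to \<open>v\<close> with itself and gets zero.\<close>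

lemma selfadj_commute:
  assumes "finite \<Omega>" "selfadj \<Omega> A" "selfadj \<Omega> B" "selfadj \<Omega> (\<lambda>v. A (B v))" and v: "v \<in> supp_on \<Omega>"
  shows "A (B v) = B (A v)"
proof -
  let ?w = "A (B v) - B (A v)"
  have AB: "A u \<in> supp_on \<Omega>" "B u \<in> supp_on \<Omega>" if "u \<in> supp_on \<Omega>" for u
    using assms that by (auto simp: selfadj_def)
  have w: "?w \<in> supp_on \<Omega>" using AB v by (intro csubspace_funD(4)[OF csubspace_supp_on]) auto
  have "inner_on \<Omega> (A (B v)) ?w = inner_on \<Omega> v (A (B ?w))"
    using assms(4) v w by (simp add: selfadj_def)
  also have "\<dots> = inner_on \<Omega> (B (A v)) ?w"
    using assms(2,3) v w AB by (simp add: selfadj_def)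
  finally have "inner_on \<Omega> ?w ?w = 0" by (simp only: inner_on_diff_left) simp
  then have "?w = 0" using w assms(1) inner_on_self_zero by blast
  then show ?thesis by (simp only: right_minus_eq)
qed

section \<open>Averaged cyclic shifts\<close>

text \<open>Both \<open>j = 0\<close> and \<open>j = 1\<close> give the identity.\<close>

definition cyc :: "nat \<Rightarrow> nat \<Rightarrow> nat" where
  "cyc j t = (if Suc t < j then Suc t else if Suc t = j then 0 else t)"

lemma cyc_permutes: "j \<le> k \<Longrightarrow> cyc j permutes {..<k}"
  by (rule inj_imp_permutes) (auto simp: cyc_def inj_on_def split: if_splits)

lemma selfadj_cscale_sum:
  assumes "\<And>x. x \<in> X \<Longrightarrow> selfadj \<Omega> (W x)"
  shows "selfadj \<Omega> (\<lambda>\<psi>. cscale (complex_of_real r) (\<Sum>x\<in>X. W x \<psi>))"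
proof -
  have lin: "linop (W x)" if "x \<in> X" for x using assms[OF that] by (simp add: selfadj_iff)
  have supp: "W x \<psi> \<in> supp_on \<Omega>" if "x \<in> X" "\<psi> \<in> supp_on \<Omega>" for x \<psi>
    using assms[OF that(1)] that(2) by (auto simp: selfadj_iff)
  have "linop (\<lambda>\<psi>. cscale (complex_of_real r) (\<Sum>x\<in>X. W x \<psi>))"
    unfolding linop_def
    by (intro conjI allI)
       (simp_all only: linop_add[OF lin] linop_cscale[OF lin] sum.distrib cscale_add cscale_sum cscale_simps mult.commute cong: sum.cong)
  moreover have "cscale (complex_of_real r) (\<Sum>x\<in>X. W x \<psi>) \<in> supp_on \<Omega>" if "\<psi> \<in> supp_on \<Omega>" for \<psi>
    using supp that by (intro csubspace_funD(3)[OF csubspace_supp_on] sum_fun_supp) auto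
  moreover have "inner_on \<Omega> u (cscale (complex_of_real r) (\<Sum>x\<in>X. W x v)) = inner_on \<Omega> (cscale (complex_of_real r) (\<Sum>x\<in>X. W x u)) v"
    if uv: "u \<in> supp_on \<Omega>" "v \<in> supp_on \<Omega>" for u v
    unfolding inner_on_cscale_left inner_on_cscale_right inner_on_sum_left inner_on_sum_right
    using selfadjD[OF assms uv] by simp
  ultimately show ?thesis unfolding selfadj_iff adjoint_on_def image_subset_iff by blast
qed

lemma twirl_locop_selfadj:
  assumes Q: "hermitian_mat d Q" and p: "p permutes {..<k}" and u: "u < k"
  shows "selfadj (configs d k) (twirl k (\<lambda>\<psi>. locop d Q u (permop p \<psi>)))"
proof -
  let ?G = "\<lambda>\<psi>. locop d Q u (permop p \<psi>)" and ?G' = "\<lambda>\<psi>. permop (finv p) (locop d Q u \<psi>)"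
  let ?S = "supp_on (configs d k)"
  have q: "finv p permutes {..<k}" using p by (rule permutes_inv)
  have supp: "?G ` ?S \<subseteq> ?S" "?G' ` ?S \<subseteq> ?S"
    by (auto intro!: permop_supp locop_supp p q u)
  have "adjoint_on (configs d k) ?G ?G'"
    by (rule adjoint_on_comp[OF adjoint_on_locop[OF Q u] adjoint_on_permop[OF p]])
       (auto intro!: permop_supp locop_supp p u)
  then have adj: "adjoint_on (configs d k) (twirl k ?G) (twirl k ?G')"
    using supp by (rule adjoint_on_twirl)
  \<comment> \<open>With \<open>v = u\<close> the two alternatives of the reflection lemma
    coincide.\<close>
  obtain \<tau> where \<tau>: "\<tau> permutes {..<k}" "\<And>x. \<tau> (p x) = finv p (\<tau> x)" "\<tau> u = finv p u"
    using permutation_conj_inverse[OF p finite_lessThan, of u u] by metis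
  have conj: "\<tau> \<circ> p \<circ> finv \<tau> = finv p"
  proof -
    have "\<tau> \<circ> p = finv p \<circ> \<tau>" by (rule ext) (simp only: o_apply \<tau>(2))
    then show ?thesis by (simp only: o_assoc[symmetric] permutes_inv_o(1)[OF \<tau>(1)] o_id)
  qed
  have "permop \<tau> (?G (permop (finv \<tau>) \<psi>)) = locop d Q (\<tau> u) (permop (finv p) \<psi>)" for \<psi>
    unfolding permop_locop[OF permutes_inj[OF \<tau>(1)]] permop_permop conj[symmetric] by (simp only: o_assoc)
  moreover have "?G' \<psi> = locop d Q (finv p u) (permop (finv p) \<psi>)" for \<psi>
    by (rule permop_locop[OF permutes_inj[OF q]])
  ultimately have "permop \<tau> (?G (permop (finv \<tau>) \<psi>)) = ?G' \<psi>" for \<psi>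
    by (simp only: \<tau>(3))
  then have "(\<lambda>\<psi>. permop \<tau> (?G (permop (finv \<tau>) \<psi>))) = ?G'" by (rule ext)
  from arg_cong[OF this, of "twirl k"] twirl_conj[OF \<tau>(1), of ?G]
  have eq: "twirl k ?G' = twirl k ?G" by (rule trans[OF sym])
  have "linop (twirl k ?G)" by (rule linop_twirl[OF linop_comp[OF linop_locop linop_permop]])
  moreover have "twirl k ?G ` ?S \<subseteq> ?S" using supp by (auto intro!: twirl_supp)
  ultimately show ?thesis using adj unfolding selfadj_iff eq by (intro conjI)
qed

lemma twirl_locop_locop_selfadj:
  assumes Q: "hermitian_mat d Q" and p: "p permutes {..<k}" and u: "u < k" and v: "v < k"
  shows "selfadj (configs d k) (twirl k (\<lambda>\<psi>. locop d Q u (locop d Q v (permop p \<psi>))))"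
proof -
  let ?G = "\<lambda>\<psi>. locop d Q u (locop d Q v (permop p \<psi>))"
  let ?G' = "\<lambda>\<psi>. permop (finv p) (locop d Q v (locop d Q u \<psi>))"
  let ?S = "supp_on (configs d k)"
  have q: "finv p permutes {..<k}" using p by (rule permutes_inv)
  have supp: "?G ` ?S \<subseteq> ?S" "?G' ` ?S \<subseteq> ?S"
    by (auto intro!: permop_supp locop_supp p q u v)
  have "adjoint_on (configs d k) (\<lambda>\<psi>. locop d Q v (permop p \<psi>)) (\<lambda>\<psi>. permop (finv p) (locop d Q v \<psi>))"
    by (rule adjoint_on_comp[OF adjoint_on_locop[OF Q v] adjoint_on_permop[OF p]])
       (auto intro!: permop_supp locop_supp p v)
  then have "adjoint_on (configs d k) ?G ?G'"
    by (rule adjoint_on_comp[OF adjoint_on_locop[OF Q u]])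
       (auto intro!: permop_supp locop_supp p u v)
  then have adj: "adjoint_on (configs d k) (twirl k ?G) (twirl k ?G')"
    using supp by (rule adjoint_on_twirl)
  obtain \<tau> where \<tau>: "\<tau> permutes {..<k}" "\<And>x. \<tau> (p x) = finv p (\<tau> x)"
    and uv: "\<tau> u = finv p u \<and> \<tau> v = finv p v \<or> \<tau> u = finv p v \<and> \<tau> v = finv p u"
    using permutation_conj_inverse[OF p finite_lessThan, of u v] by metis
  have conj: "\<tau> \<circ> p \<circ> finv \<tau> = finv p"
  proof -
    have "\<tau> \<circ> p = finv p \<circ> \<tau>" by (rule ext) (simp only: o_apply \<tau>(2))
    then show ?thesis by (simp only: o_assoc[symmetric] permutes_inv_o(1)[OF \<tau>(1)] o_id)
  qed
  have "permop \<tau> (?G (permop (finv \<tau>) \<psi>)) = locop d Q (\<tau> u) (locop d Q (\<tau> v) (permop (finv p) \<psi>))" for \<psi>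
    unfolding permop_locop[OF permutes_inj[OF \<tau>(1)]] permop_permop conj[symmetric] by (simp only: o_assoc)
  moreover have "?G' \<psi> = locop d Q (finv p v) (locop d Q (finv p u) (permop (finv p) \<psi>))" for \<psi>
    by (simp only: permop_locop[OF permutes_inj[OF q]])
  \<comment> \<open>In the swapped alternative the two sides already agree; in the unswapped one the
    two local copies of \<open>Q\<close> have to be interchanged.\<close>
  moreover have "locop d Q (\<tau> u) (locop d Q (\<tau> v) \<psi>) = locop d Q (finv p v) (locop d Q (finv p u) \<psi>)" for \<psi>
    using uv
  proof (elim disjE conjE)
    assume "\<tau> u = finv p u" "\<tau> v = finv p v"
    then show ?thesis by (simp only: locop_commute)
  qed (simp only:)
  ultimately have "permop \<tau> (?G (permop (finv \<tau>) \<psi>)) = ?G' \<psi>" for \<psi>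
    by (simp only:)
  then have "(\<lambda>\<psi>. permop \<tau> (?G (permop (finv \<tau>) \<psi>))) = ?G'" by (rule ext)
  from arg_cong[OF this, of "twirl k"] twirl_conj[OF \<tau>(1), of ?G]
  have eq: "twirl k ?G' = twirl k ?G" by (rule trans[OF sym])
  have "linop (twirl k ?G)" by (rule linop_twirl[OF linop_comp[OF linop_locop linop_comp[OF linop_locop linop_permop]]])
  moreover have "twirl k ?G ` ?S \<subseteq> ?S" using supp by (auto intro!: twirl_supp)
  ultimately show ?thesis using adj unfolding selfadj_iff eq by (intro conjI)
qed

text \<open>The operator \<open>A\<^sub>j\<close> of the overview, factor \<open>0\<close> being the
  first copy.\<close>

definition shift_op where
  "shift_op d k Q j = twirl k (\<lambda>\<psi>. locop d Q 0 (permop (cyc j) \<psi>))"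

lemma shift_op_selfadj:
  assumes "hermitian_mat d Q" "j \<le> k" "0 < k"
  shows "selfadj (configs d k) (shift_op d k Q j)"
  unfolding shift_op_def using assms by (intro twirl_locop_selfadj cyc_permutes)

text \<open>For each relative permutation \<sigma> the product is a word with exactly two local
  operators, at \<open>0\<close> and at \<open>(cyc i \<circ> \<sigma>) 0\<close>, followed by the
  single permutation
  \<open>cyc i \<circ> \<sigma> \<circ> cyc j \<circ> finv \<sigma>\<close>.\<close>

lemma shift_op_comp_selfadj:
  assumes Q: "hermitian_mat d Q" and "i \<le> k" "j \<le> k" "0 < k"
  shows "selfadj (configs d k) (\<lambda>\<psi>. shift_op d k Q i (shift_op d k Q j \<psi>))"
proof -
  let ?W = "\<lambda>\<sigma>. twirl k (\<lambda>\<psi>. locop d Q 0 (permop (cyc i) (permop \<sigma> (locop d Q 0 (permop (cyc j) (permop (finv \<sigma>) \<psi>))))))"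
  have "selfadj (configs d k) (?W \<sigma>)" if "\<sigma> \<in> {\<sigma>. \<sigma> permutes {..<k}}" for \<sigma>
  proof -
    have \<sigma>: "\<sigma> permutes {..<k}" using that by simp
    have ci: "cyc i permutes {..<k}" "cyc j permutes {..<k}" using assms by (auto intro: cyc_permutes)
    have p: "(cyc i \<circ> \<sigma>) permutes {..<k}" "(cyc i \<circ> \<sigma> \<circ> cyc j \<circ> finv \<sigma>) permutes {..<k}"
      by (intro permutes_compose permutes_inv ci \<sigma>)+
    have "locop d Q 0 (permop (cyc i) (permop \<sigma> (locop d Q 0 (permop (cyc j) (permop (finv \<sigma>) \<psi>)))))
      = locop d Q 0 (locop d Q ((cyc i \<circ> \<sigma>) 0) (permop (cyc i \<circ> \<sigma> \<circ> cyc j \<circ> finv \<sigma>) \<psi>))" for \<psi>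
      unfolding permop_permop permop_locop[OF permutes_inj[OF p(1)]] by (simp only: o_assoc)
    moreover have "(cyc i \<circ> \<sigma>) 0 < k" using permutes_in_image[OF p(1), of 0] assms by simp
    ultimately show ?thesis using twirl_locop_locop_selfadj[OF Q p(2) \<open>0 < k\<close>] by simp
  qed
  from selfadj_cscale_sum[where r = "1 / fact k" and W = ?W and X = "{\<sigma>. \<sigma> permutes {..<k}}", OF this]
  show ?thesis unfolding shift_op_def twirl_comp[OF linop_comp[OF linop_locop linop_permop]]
    by simp
qed

lemma shift_op_commute:
  assumes "hermitian_mat d Q" "i \<le> k" "j \<le> k" "0 < k" "\<psi> \<in> supp_on (configs d k)"
  shows "shift_op d k Q i (shift_op d k Q j \<psi>) = shift_op d k Q j (shift_op d k Q i \<psi>)"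
  using selfadj_commute[where A = "shift_op d k Q i" and B = "shift_op d k Q j", OF finite_configs shift_op_selfadj[OF assms(1,2,4)] shift_op_selfadj[OF assms(1,3,4)]
      shift_op_comp_selfadj[OF assms(1-4)] assms(5)] .

section \<open>Norm bounds for the averaged shifts\<close>

definition sq_norm :: "'i set \<Rightarrow> ('i \<Rightarrow> complex) \<Rightarrow> real" where
  "sq_norm \<Omega> v = (\<Sum>i\<in>\<Omega>. (cmod (v i))\<^sup>2)"

lemma sq_norm_permop: "p permutes {..<k} \<Longrightarrow> sq_norm (configs d k) (permop p \<psi>) = sq_norm (configs d k) \<psi>"
  unfolding sq_norm_def permop_def by (rule sum_configs_comp)

text \<open>With the other entries frozen, \<psi> is a vector in dimension \<open>d\<close> along
  coordinate \<open>u\<close>, and the bound for \<open>Q\<close> applies to it. Summing over all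
  \<open>f\<close> and all new entries counts each configuration \<open>d\<close> times, which
  spares choosing fibre representatives; the factor cancels.\<close>

lemma sq_norm_locop:
  assumes Q: "\<And>w. (\<Sum>a<d. (cmod (\<Sum>b<d. Q $$ (a, b) * w b))\<^sup>2) \<le> C * (\<Sum>b<d. (cmod (w b))\<^sup>2)"
    and u: "u < k" and d: "0 < d"
  shows "sq_norm (configs d k) (locop d Q u \<psi>) \<le> C * sq_norm (configs d k) \<psi>"
proof -
  have avg: "real d * (\<Sum>f\<in>configs d k. F f) = (\<Sum>f\<in>configs d k. \<Sum>a<d. F (f(u := a)))" for F :: "(nat \<Rightarrow> nat) \<Rightarrow> real"
    using sum_configs_exchange[OF u, of "\<lambda>f b. F f" d] by (simp add: sum_distrib_left)
  have "real d * sq_norm (configs d k) (locop d Q u \<psi>) =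
      (\<Sum>f\<in>configs d k. \<Sum>a<d. (cmod (\<Sum>b<d. Q $$ (a, b) * \<psi> (f(u := b))))\<^sup>2)"
    unfolding sq_norm_def avg by (intro sum.cong refl) (simp add: locop_def)
  also have "\<dots> \<le> (\<Sum>f\<in>configs d k. C * (\<Sum>b<d. (cmod (\<psi> (f(u := b))))\<^sup>2))"
    by (intro sum_mono Q)
  also have "\<dots> = real d * (C * sq_norm (configs d k) \<psi>)"
    unfolding sq_norm_def sum_distrib_left[symmetric] avg[of "\<lambda>f. (cmod (\<psi> f))\<^sup>2", symmetric] by simp
  finally show ?thesis using d by simp
qed

lemma sum_fun_apply: "(sum w X) i = (\<Sum>x\<in>X. w x i)"
  by (induction X rule: infinite_finite_induct) auto

text \<open>Convexity of the square, via Cauchy-Schwarz on the \<open>fact k\<close> summands,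
  together with permutation operators being isometries.\<close>

lemma sq_norm_twirl:
  assumes "\<And>\<psi>. sq_norm (configs d k) (G \<psi>) \<le> C * sq_norm (configs d k) \<psi>"
  shows "sq_norm (configs d k) (twirl k G \<psi>) \<le> C * sq_norm (configs d k) \<psi>"
proof -
  let ?P = "{\<tau>. \<tau> permutes {..<k}}" and ?t = "\<lambda>\<tau>. permop \<tau> (G (permop (finv \<tau>) \<psi>))"
  have card: "card ?P = fact k" by (simp add: card_permutations[of _ k])
  have "(cmod (twirl k G \<psi> f))\<^sup>2 \<le> 1 / fact k * (\<Sum>\<tau>\<in>?P. (cmod (?t \<tau> f))\<^sup>2)" for f
  proof -
    have "cmod (twirl k G \<psi> f) = cmod (\<Sum>\<tau>\<in>?P. ?t \<tau> f) / fact k"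
      by (simp add: twirl_def cscale_def sum_fun_apply norm_divide)
    also have "\<dots> \<le> (\<Sum>\<tau>\<in>?P. cmod (?t \<tau> f)) / fact k"
      by (intro divide_right_mono norm_sum) simp
    finally have "(cmod (twirl k G \<psi> f))\<^sup>2 \<le> ((\<Sum>\<tau>\<in>?P. cmod (?t \<tau> f)) / fact k)\<^sup>2"
      by (intro power_mono) auto
    also have "\<dots> \<le> ((\<Sum>\<tau>\<in>?P. (cmod (?t \<tau> f))\<^sup>2) * fact k) / (fact k)\<^sup>2"
      unfolding power_divide using sum_squared_le_sum_of_squares[of "\<lambda>\<tau>. cmod (?t \<tau> f)" ?P]
      by (intro divide_right_mono) (simp_all add: card)
    finally show ?thesis by (simp add: power2_eq_square)
  qed
  then have "sq_norm (configs d k) (twirl k G \<psi>) \<le> (\<Sum>f\<in>configs d k. 1 / fact k * (\<Sum>\<tau>\<in>?P. (cmod (?t \<tau> f))\<^sup>2))"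
    unfolding sq_norm_def by (intro sum_mono)
  also have "\<dots> = 1 / fact k * (\<Sum>\<tau>\<in>?P. sq_norm (configs d k) (?t \<tau>))"
    unfolding sq_norm_def sum_distrib_left[symmetric] by (subst sum.swap) simp
  also have "\<dots> \<le> 1 / fact k * (\<Sum>\<tau>\<in>?P. C * sq_norm (configs d k) \<psi>)"
  proof (intro mult_left_mono sum_mono)
    fix \<tau> assume "\<tau> \<in> ?P"
    then have \<tau>: "\<tau> permutes {..<k}" by simp
    show "sq_norm (configs d k) (?t \<tau>) \<le> C * sq_norm (configs d k) \<psi>"
      using assms[of "permop (finv \<tau>) \<psi>"] sq_norm_permop[OF \<tau>] sq_norm_permop[OF permutes_inv[OF \<tau>]] by simp
  qed simp
  also have "\<dots> = C * sq_norm (configs d k) \<psi>" by (simp add: card)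
  finally show ?thesis .
qed

lemma sq_norm_shift_op:
  assumes "\<And>w. (\<Sum>a<d. (cmod (\<Sum>b<d. Q $$ (a, b) * w b))\<^sup>2) \<le> C * (\<Sum>b<d. (cmod (w b))\<^sup>2)"
    and "0 < k" "0 < d" "j \<le> k"
  shows "sq_norm (configs d k) (shift_op d k Q j \<psi>) \<le> C * sq_norm (configs d k) \<psi>"
  unfolding shift_op_def
  by (rule sq_norm_twirl, rule order_trans[OF sq_norm_locop[OF assms(1-3)]])
     (simp add: sq_norm_permop cyc_permutes assms(4))

section \<open>Traces against product states\<close>

lemma mult_mat_vec_vec:
  assumes "Q \<in> carrier_mat d d" "a < d"
  shows "vec_index (Q *\<^sub>v Matrix.vec d w) a = (\<Sum>b<d. Q $$ (a, b) * w b)"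
  using assms by (auto simp: scalar_prod_def lessThan_atLeast0 intro!: sum.cong)

text \<open>The supremum defining \<open>op_norm\<close> can be used only once the set is known to
  be bounded. A crude bound suffices: entries of a vector in the unit ball have modulus at most
  1.\<close>

lemma op_norm_bdd:
  assumes Q: "Q \<in> carrier_mat d d"
  shows "bdd_above {cvec_norm (Q *\<^sub>v v) | v. v \<in> carrier_vec d \<and> cvec_norm v \<le> 1}"
proof (rule bdd_aboveI, clarify)
  fix v :: "complex Matrix.vec" assume v: "v \<in> carrier_vec d" and n: "cvec_norm v \<le> 1"
  have "(\<Sum>i<d. (cmod (vec_index v i))\<^sup>2) \<le> 1"
    using n v by (simp add: cvec_norm_def)
  then have "(cmod (vec_index v i))\<^sup>2 \<le> 1" if "i < d" for i
    using member_le_sum[of i "{..<d}" "\<lambda>i. (cmod (vec_index v i))\<^sup>2"] that by auto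
  then have v1: "cmod (vec_index v i) \<le> 1" if "i < d" for i
    using that by (simp add: power_le_one_iff)
  have "v = Matrix.vec d (vec_index v)" using v by auto
  then have entry: "vec_index (Q *\<^sub>v v) a = (\<Sum>b<d. Q $$ (a, b) * vec_index v b)" if "a < d" for a
    using mult_mat_vec_vec[OF Q that, of "vec_index v"] by simp
  have "cmod (vec_index (Q *\<^sub>v v) a) \<le> (\<Sum>b<d. cmod (Q $$ (a, b)))" if "a < d" for a
    unfolding entry[OF that]
    by (rule order_trans[OF norm_sum]) (intro sum_mono, simp add: norm_mult mult_left_le v1)
  then show "cvec_norm (Q *\<^sub>v v) \<le> sqrt (\<Sum>a<d. (\<Sum>b<d. cmod (Q $$ (a, b)))\<^sup>2)"
    using Q by (auto simp: cvec_norm_def intro!: real_sqrt_le_mono sum_mono power_mono)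
qed

lemma op_norm_bound:
  assumes Q: "Q \<in> carrier_mat d d"
  shows "(\<Sum>a<d. (cmod (\<Sum>b<d. Q $$ (a, b) * w b))\<^sup>2) \<le> (op_norm d Q)\<^sup>2 * (\<Sum>b<d. (cmod (w b))\<^sup>2)"
proof (cases "(\<Sum>b<d. (cmod (w b))\<^sup>2) = 0")
  case True
  then have "\<forall>b<d. w b = 0" by (simp add: sum_nonneg_eq_0_iff)
  then show ?thesis by simp
next
  case False
  define s where "s = (\<Sum>b<d. (cmod (w b))\<^sup>2)"
  have s: "s > 0" using False by (simp add: s_def less_le sum_nonneg)
  define v where "v = Matrix.vec d (\<lambda>b. w b / sqrt s)"
  have "(\<Sum>b<d. (cmod (w b / sqrt s))\<^sup>2) = 1"
    using s by (simp add: norm_divide power_divide sum_divide_distrib[symmetric] s_def[symmetric])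
  then have "cvec_norm v = 1" by (simp add: cvec_norm_def v_def)
  then have le: "cvec_norm (Q *\<^sub>v v) \<le> op_norm d Q"
    unfolding op_norm_def by (intro cSup_upper op_norm_bdd Q) (auto simp: v_def)
  have e1: "(cvec_norm (Q *\<^sub>v v))\<^sup>2 = (\<Sum>a<d. (cmod (vec_index (Q *\<^sub>v v) a))\<^sup>2)"
    using Q by (simp add: cvec_norm_def sum_nonneg)
  have "vec_index (Q *\<^sub>v v) a = (\<Sum>b<d. Q $$ (a, b) * w b) / sqrt s" if "a < d" for a
    unfolding v_def mult_mat_vec_vec[OF Q that] by (simp add: sum_divide_distrib)
  then have e2: "(\<Sum>a<d. (cmod (vec_index (Q *\<^sub>v v) a))\<^sup>2) = (\<Sum>a<d. (cmod (\<Sum>b<d. Q $$ (a, b) * w b))\<^sup>2 / s)"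
    using s by (intro sum.cong refl) (simp add: norm_divide power_divide)
  have "(cvec_norm (Q *\<^sub>v v))\<^sup>2 = (\<Sum>a<d. (cmod (\<Sum>b<d. Q $$ (a, b) * w b))\<^sup>2) / s"
    unfolding e1 e2 by (simp add: sum_divide_distrib)
  moreover have "(cvec_norm (Q *\<^sub>v v))\<^sup>2 \<le> (op_norm d Q)\<^sup>2"
    using le by (intro power_mono) (auto simp: cvec_norm_def sum_nonneg)
  ultimately have "(\<Sum>a<d. (cmod (\<Sum>b<d. Q $$ (a, b) * w b))\<^sup>2) / s \<le> (op_norm d Q)\<^sup>2" by simp
  then show ?thesis using s unfolding s_def[symmetric] by (simp add: pos_divide_le_eq)
qed

lemma op_norm_nonneg:
  assumes "Q \<in> carrier_mat d d"
  shows "0 \<le> op_norm d Q"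
proof -
  have "cvec_norm (Q *\<^sub>v 0\<^sub>v d) \<le> op_norm d Q"
    unfolding op_norm_def by (intro cSup_upper op_norm_bdd assms) (auto simp: cvec_norm_def)
  moreover have "0 \<le> cvec_norm (Q *\<^sub>v 0\<^sub>v d)" by (simp add: cvec_norm_def sum_nonneg)
  ultimately show ?thesis by linarith
qed

section \<open>Matrix powers and traces as sums over index paths\<close>

lemma index_mult_mat_sum:
  assumes "A \<in> carrier_mat n m" "B \<in> carrier_mat m l" "i < n" "j < l"
  shows "(A * B) $$ (i, j) = (\<Sum>e<m. A $$ (i, e) * B $$ (e, j))"
  using assms by (auto simp: scalar_prod_def lessThan_atLeast0 intro!: sum.cong)

lemma pow_mat_Suc_left:
  assumes "A \<in> carrier_mat n n"
  shows "A * A ^\<^sub>m j = A ^\<^sub>m Suc j"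
proof (induction j)
  case (Suc j)
  then show ?case
    using assoc_mult_mat[OF assms pow_carrier_mat[OF assms, of j] assms] by simp
qed (use assms in simp)

lemma pow_mat_Suc_index:
  assumes "A \<in> carrier_mat d d" "i < d" "j < d"
  shows "(\<Sum>e<d. A $$ (i, e) * (A ^\<^sub>m n) $$ (e, j)) = (A ^\<^sub>m Suc n) $$ (i, j)"
  using index_mult_mat_sum[OF assms(1) pow_carrier_mat[OF assms(1), of n] assms(2,3)]
  by (simp only: pow_mat_Suc_left[OF assms(1)])

text \<open>A configuration is a path from \<open>f 0\<close> to \<open>f n\<close>, and summing
  over its inner points gives an entry of the \<open>n\<close>-th power. The arbitrary weight
  \<open>H\<close> on the endpoints absorbs the last edge in the induction.\<close>

lemma sum_configs_chain:
  assumes \<rho>: "\<rho> \<in> carrier_mat d d"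
  shows "(\<Sum>f\<in>configs d (Suc n). (\<Prod>t<n. \<rho> $$ (f (Suc t), f t)) * H (f 0) (f n))
    = (\<Sum>a<d. \<Sum>e<d. (\<rho> ^\<^sub>m n) $$ (e, a) * H a e)"
proof (induction n arbitrary: H)
  case 0
  have "(\<Sum>e<d. (\<rho> ^\<^sub>m 0) $$ (e, a) * H a e) = H a a" if "a < d" for a
    using \<rho> that by (simp add: one_mat_def if_distrib[of "\<lambda>x. x * _"] cong: if_cong)
  then show ?case by (simp add: sum_configs_Suc)
next
  case (Suc n)
  have "(\<Sum>f\<in>configs d (Suc (Suc n)). (\<Prod>t<Suc n. \<rho> $$ (f (Suc t), f t)) * H (f 0) (f (Suc n)))
      = (\<Sum>f\<in>configs d (Suc n). (\<Prod>t<n. \<rho> $$ (f (Suc t), f t)) * (\<Sum>c<d. \<rho> $$ (c, f n) * H (f 0) c))"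
    unfolding sum_configs_Suc[where k = "Suc n"]
  proof (rule sum.cong[OF refl])
    fix f
    have "(\<Prod>t<n. \<rho> $$ ((f(Suc n := c)) (Suc t), (f(Suc n := c)) t)) = (\<Prod>t<n. \<rho> $$ (f (Suc t), f t))" for c
      by (intro prod.cong) auto
    then show "(\<Sum>c<d. (\<Prod>t<Suc n. \<rho> $$ ((f(Suc n := c)) (Suc t), (f(Suc n := c)) t)) *
        H ((f(Suc n := c)) 0) ((f(Suc n := c)) (Suc n)))
      = (\<Prod>t<n. \<rho> $$ (f (Suc t), f t)) * (\<Sum>c<d. \<rho> $$ (c, f n) * H (f 0) c)"
      by (simp add: sum_distrib_left mult.assoc)
  qed
  also have "\<dots> = (\<Sum>a<d. \<Sum>e<d. (\<rho> ^\<^sub>m n) $$ (e, a) * (\<Sum>c<d. \<rho> $$ (c, e) * H a c))"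
    by (rule Suc.IH)
  also have "\<dots> = (\<Sum>a<d. \<Sum>c<d. (\<rho> ^\<^sub>m Suc n) $$ (c, a) * H a c)"
  proof (rule sum.cong[OF refl])
    fix a assume a: "a \<in> {..<d}"
    have "(\<Sum>e<d. (\<rho> ^\<^sub>m n) $$ (e, a) * (\<Sum>c<d. \<rho> $$ (c, e) * H a c))
      = (\<Sum>c<d. (\<Sum>e<d. \<rho> $$ (c, e) * (\<rho> ^\<^sub>m n) $$ (e, a)) * H a c)"
      unfolding sum_distrib_left sum_distrib_right by (subst sum.swap) (simp add: mult_ac)
    also have "\<dots> = (\<Sum>c<d. (\<rho> ^\<^sub>m Suc n) $$ (c, a) * H a c)"
      using a by (intro sum.cong refl arg_cong2[where f = "(*)"] pow_mat_Suc_index \<rho>) simp_all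
    finally show "(\<Sum>e<d. (\<rho> ^\<^sub>m n) $$ (e, a) * (\<Sum>c<d. \<rho> $$ (c, e) * H a c))
      = (\<Sum>c<d. (\<rho> ^\<^sub>m Suc n) $$ (c, a) * H a c)" .
  qed
  finally show ?case .
qed

text \<open>For \<open>k = j\<close> the observable closes the path of \<rho>-factors into a loop,
  which gives the trace. Each further copy is fixed by the cycle and contributes the factor
  \<open>tr \<rho> = 1\<close>.\<close>

lemma cyclic_shift_trace:
  assumes \<rho>: "\<rho> \<in> carrier_mat d d" and Q: "Q \<in> carrier_mat d d"
    and tr: "(\<Sum>a<d. \<rho> $$ (a, a)) = 1" and "0 < j" "j \<le> k"
  shows "(\<Sum>f\<in>configs d k. \<Sum>b<d. Q $$ (f 0, b) * (\<Prod>t<k. \<rho> $$ ((f(0 := b)) (cyc j t), f t)))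
    = mtrace (Q * \<rho> ^\<^sub>m j)"
  using \<open>j \<le> k\<close>
proof (induction k rule: dec_induct)
  case base
  obtain n where n: "j = Suc n" using \<open>0 < j\<close> by (cases j) auto
  have "(\<Sum>b<d. Q $$ (f 0, b) * (\<Prod>t<j. \<rho> $$ ((f(0 := b)) (cyc j t), f t)))
    = (\<Prod>t<n. \<rho> $$ (f (Suc t), f t)) * (\<Sum>b<d. Q $$ (f 0, b) * \<rho> $$ (b, f n))" for f
  proof -
    have "(\<Prod>t<n. \<rho> $$ ((f(0 := b)) (cyc j t), f t)) = (\<Prod>t<n. \<rho> $$ (f (Suc t), f t))" for b
      by (intro prod.cong) (auto simp: cyc_def n)
    then show ?thesis by (simp add: n cyc_def sum_distrib_left mult_ac)
  qed
  then have "(\<Sum>f\<in>configs d j. \<Sum>b<d. Q $$ (f 0, b) * (\<Prod>t<j. \<rho> $$ ((f(0 := b)) (cyc j t), f t)))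
    = (\<Sum>a<d. \<Sum>e<d. (\<rho> ^\<^sub>m n) $$ (e, a) * (\<Sum>b<d. Q $$ (a, b) * \<rho> $$ (b, e)))"
    unfolding n using sum_configs_chain[OF \<rho>, where n = n and H = "\<lambda>a e. \<Sum>b<d. Q $$ (a, b) * \<rho> $$ (b, e)"]
    by (simp only:)
  also have "\<dots> = (\<Sum>a<d. (Q * \<rho> ^\<^sub>m j) $$ (a, a))"
  proof (rule sum.cong[OF refl])
    fix a assume a: "a \<in> {..<d}"
    have "(\<Sum>e<d. (\<rho> ^\<^sub>m n) $$ (e, a) * (\<Sum>b<d. Q $$ (a, b) * \<rho> $$ (b, e)))
      = (\<Sum>b<d. Q $$ (a, b) * (\<Sum>e<d. \<rho> $$ (b, e) * (\<rho> ^\<^sub>m n) $$ (e, a)))"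
      unfolding sum_distrib_left by (subst sum.swap) (simp add: mult_ac)
    also have "\<dots> = (\<Sum>b<d. Q $$ (a, b) * (\<rho> ^\<^sub>m j) $$ (b, a))"
      using a unfolding n
      by (intro sum.cong refl arg_cong2[where f = "(*)"] pow_mat_Suc_index \<rho>) simp_all
    also have "\<dots> = (Q * \<rho> ^\<^sub>m j) $$ (a, a)"
      using a index_mult_mat_sum[OF Q pow_carrier_mat[OF \<rho>], of a a j] by simp
    finally show "(\<Sum>e<d. (\<rho> ^\<^sub>m n) $$ (e, a) * (\<Sum>b<d. Q $$ (a, b) * \<rho> $$ (b, e)))
      = (Q * \<rho> ^\<^sub>m j) $$ (a, a)" .
  qed
  finally show ?case using Q by (simp add: mtrace_def)
next
  case (step k)
  have "(\<Sum>c<d. \<Sum>b<d. Q $$ ((f(k := c)) 0, b) * (\<Prod>t<Suc k. \<rho> $$ ((f(k := c, 0 := b)) (cyc j t), (f(k := c)) t)))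
    = (\<Sum>b<d. Q $$ (f 0, b) * (\<Prod>t<k. \<rho> $$ ((f(0 := b)) (cyc j t), f t)))" for f
  proof -
    have k: "k \<noteq> 0" "cyc j k = k" using step \<open>0 < j\<close> by (auto simp: cyc_def)
    have "(\<Prod>t<k. \<rho> $$ ((f(k := c, 0 := b)) (cyc j t), (f(k := c)) t)) = (\<Prod>t<k. \<rho> $$ ((f(0 := b)) (cyc j t), f t))" for b c
      using step by (intro prod.cong) (auto simp: cyc_def)
    then have "(\<Sum>c<d. \<Sum>b<d. Q $$ ((f(k := c)) 0, b) * (\<Prod>t<Suc k. \<rho> $$ ((f(k := c, 0 := b)) (cyc j t), (f(k := c)) t)))
      = (\<Sum>c<d. \<Sum>b<d. Q $$ (f 0, b) * (\<Prod>t<k. \<rho> $$ ((f(0 := b)) (cyc j t), f t)) * \<rho> $$ (c, c))"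
      using k by (simp add: mult.assoc)
    also have "\<dots> = (\<Sum>b<d. Q $$ (f 0, b) * (\<Prod>t<k. \<rho> $$ ((f(0 := b)) (cyc j t), f t)) * (\<Sum>c<d. \<rho> $$ (c, c)))"
      unfolding sum_distrib_left by (rule sum.swap)
    finally show ?thesis by (simp add: tr)
  qed
  then show ?case using step by (simp only: sum_configs_Suc)
qed

text \<open>Column \<open>f\<close> of the matrix of the \<open>k\<close>-fold tensor power of
  \<rho>, in the basis of configurations.\<close>

definition state_fun :: "nat \<Rightarrow> nat \<Rightarrow> complex mat \<Rightarrow> (nat \<Rightarrow> nat) \<Rightarrow> (nat \<Rightarrow> nat) \<Rightarrow> complex" where
  "state_fun d k \<rho> f = (\<lambda>g. if g \<in> configs d k then \<Prod>t<k. \<rho> $$ (g t, f t) else 0)"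

lemma permop_state_fun:
  assumes \<tau>: "\<tau> permutes {..<k}"
  shows "permop (finv \<tau>) (state_fun d k \<rho> f) = state_fun d k \<rho> (f \<circ> \<tau>)"
proof
  fix g
  have "(\<Prod>t<k. \<rho> $$ (g (finv \<tau> t), f t)) = (\<Prod>t<k. \<rho> $$ (g t, f (\<tau> t)))"
    by (rule prod.reindex_bij_witness[of _ \<tau> "finv \<tau>"])
       (use permutes_inverses[OF \<tau>] permutes_in_image[OF \<tau>] permutes_in_image[OF permutes_inv[OF \<tau>]] in auto)
  then show "permop (finv \<tau>) (state_fun d k \<rho> f) g = state_fun d k \<rho> (f \<circ> \<tau>) g"
    by (simp add: permop_def state_fun_def configs_comp_iff[OF permutes_inv[OF \<tau>]])
qed

text \<open>The product state is invariant under relabelling, so all \<open>fact k\<close>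
  conjugates in the average have the same trace.\<close>

lemma shift_op_trace:
  assumes \<rho>: "\<rho> \<in> carrier_mat d d" and Q: "Q \<in> carrier_mat d d"
    and tr: "(\<Sum>a<d. \<rho> $$ (a, a)) = 1" and j: "0 < j" "j \<le> k"
  shows "(\<Sum>f\<in>configs d k. shift_op d k Q j (state_fun d k \<rho> f) f) = mtrace (Q * \<rho> ^\<^sub>m j)"
proof -
  let ?P = "{\<tau>. \<tau> permutes {..<k}}"
  let ?G = "\<lambda>\<psi>. locop d Q 0 (permop (cyc j) \<psi>)"
  have card: "card ?P = fact k" by (simp add: card_permutations[of _ k])
  have "?G (state_fun d k \<rho> f) f = (\<Sum>b<d. Q $$ (f 0, b) * (\<Prod>t<k. \<rho> $$ ((f(0 := b)) (cyc j t), f t)))"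
    if f: "f \<in> configs d k" for f
  proof -
    have "f(0 := b) \<circ> cyc j \<in> configs d k" if "b < d" for b
      using f j that by (subst configs_comp_iff) (auto simp: cyc_permutes configs_def)
    then show ?thesis using f j by (auto simp: locop_def permop_def state_fun_def configs_def intro!: sum.cong)
  qed
  then have G: "(\<Sum>f\<in>configs d k. ?G (state_fun d k \<rho> f) f) = mtrace (Q * \<rho> ^\<^sub>m j)"
    using cyclic_shift_trace[OF assms] by simp
  have "(\<Sum>f\<in>configs d k. shift_op d k Q j (state_fun d k \<rho> f) f)
      = (\<Sum>f\<in>configs d k. 1 / fact k * (\<Sum>\<tau>\<in>?P. ?G (state_fun d k \<rho> (f \<circ> \<tau>)) (f \<circ> \<tau>)))"
    unfolding shift_op_def twirl_def cscale_def sum_fun_apply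
    by (intro sum.cong refl arg_cong2[where f = "(*)"])
       (simp add: permop_def[of _ "?G _" for \<tau>] permop_state_fun)
  also have "\<dots> = 1 / fact k * (\<Sum>\<tau>\<in>?P. \<Sum>f\<in>configs d k. ?G (state_fun d k \<rho> (f \<circ> \<tau>)) (f \<circ> \<tau>))"
    unfolding sum_distrib_left[symmetric] by (subst sum.swap) simp
  also have "(\<Sum>\<tau>\<in>?P. \<Sum>f\<in>configs d k. ?G (state_fun d k \<rho> (f \<circ> \<tau>)) (f \<circ> \<tau>)) = (\<Sum>\<tau>\<in>?P. mtrace (Q * \<rho> ^\<^sub>m j))"
    unfolding G[symmetric] by (intro sum.cong refl sum_configs_comp) simp
  finally show ?thesis by (simp add: card)
qed

section \<open>Joint measurement of the averaged shifts\<close>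

text \<open>The Born probability of outcome \<open>x\<close> on one batch \<open>\<rho>\<^sup>\<otimes>\<^sup>k\<close>.\<close>

definition block_prob where
  "block_prob d k P \<rho> x = (\<Sum>f\<in>configs d k. \<Sum>g\<in>configs d k. P x f g * (\<Prod>t<k. \<rho> $$ (g t, f t)))"

lemma shift_measurement:
  assumes Q: "hermitian_mat d Q" and k: "0 < k" and d: "0 < d"
  obtains X :: "(nat \<Rightarrow> real) set" and P where
    "finite X"
    "\<And>x j. x \<in> X \<Longrightarrow> j \<le> k \<Longrightarrow> \<bar>x j\<bar> \<le> op_norm d Q"
    "\<And>f g. f \<in> configs d k \<Longrightarrow> g \<in> configs d k \<Longrightarrow> (\<Sum>x\<in>X. P x f g) = (if f = g then 1 else 0)"
    "\<And>x f g. x \<in> X \<Longrightarrow> f \<in> configs d k \<Longrightarrow> g \<in> configs d k \<Longrightarrow>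
       P x f g = (\<Sum>h\<in>configs d k. cnj (P x h f) * P x h g)"
    "\<And>\<rho> j. \<rho> \<in> carrier_mat d d \<Longrightarrow> (\<Sum>a<d. \<rho> $$ (a, a)) = 1 \<Longrightarrow> 0 < j \<Longrightarrow> j \<le> k \<Longrightarrow>
       (\<Sum>x\<in>X. complex_of_real (x j) * block_prob d k P \<rho> x) = mtrace (Q * \<rho> ^\<^sub>m j)"
proof -
  let ?\<Omega> = "configs d k"
  have Qc: "Q \<in> carrier_mat d d" using Q by (simp add: hermitian_mat_def)
  \<comment> \<open>Index \<open>0\<close> repeats the operator of index \<open>1\<close>; keeping
    it lets coordinate \<open>j\<close> of an outcome estimate the \<open>j\<close>-th moment
    without a shift.\<close>
  have sa: "selfadj ?\<Omega> (shift_op d k Q j)" if "j < Suc k" for j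
    using that by (intro shift_op_selfadj Q k) simp
  have lin: "linop (shift_op d k Q j)" if "j < Suc k" for j
    using sa[OF that] by (simp add: selfadj_iff)
  have comm: "shift_op d k Q i (shift_op d k Q j v) = shift_op d k Q j (shift_op d k Q i v)"
    if "i < Suc k" "j < Suc k" "v \<in> supp_on ?\<Omega>" for i j v
    using that by (intro shift_op_commute Q k) simp_all
  obtain X :: "(nat \<Rightarrow> real) set" and P where
    X: "finite X" and
    eig: "\<And>x. x \<in> X \<Longrightarrow> \<exists>v\<in>supp_on ?\<Omega>. v \<noteq> 0 \<and> (\<forall>j<Suc k. shift_op d k Q j v = cscale (x j) v)" and
    res: "\<And>f g. f \<in> ?\<Omega> \<Longrightarrow> g \<in> ?\<Omega> \<Longrightarrow> (\<Sum>x\<in>X. P x f g) = (if f = g then 1 else 0)" and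
    gram: "\<And>x f g. x \<in> X \<Longrightarrow> f \<in> ?\<Omega> \<Longrightarrow> g \<in> ?\<Omega> \<Longrightarrow> P x f g = (\<Sum>h\<in>?\<Omega>. cnj (P x h f) * P x h g)" and
    supp: "\<And>x g. x \<in> X \<Longrightarrow> g \<in> ?\<Omega> \<Longrightarrow> (\<lambda>f. P x f g) \<in> supp_on ?\<Omega>" and
    Peig: "\<And>x g j. x \<in> X \<Longrightarrow> g \<in> ?\<Omega> \<Longrightarrow> j < Suc k \<Longrightarrow>
      shift_op d k Q j (\<lambda>f. P x f g) = cscale (x j) (\<lambda>f. P x f g)"
    by (rule joint_spectral_measure[where A = "shift_op d k Q" and n = "Suc k", OF finite_configs sa comm];
        (assumption | (rule that; assumption)))
  show thesis
  proof (rule that[of X P])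
    fix x j assume xj: "x \<in> X" "j \<le> k"
    obtain v where v: "v \<in> supp_on ?\<Omega>" "v \<noteq> 0" "\<forall>j<Suc k. shift_op d k Q j v = cscale (x j) v"
      using eig[OF xj(1)] by (elim bexE conjE)
    have e: "shift_op d k Q j v = cscale (x j) v" using v(3) xj(2) by simp
    have "inner_on ?\<Omega> v v \<noteq> 0" using inner_on_self_zero[OF finite_configs v(1)] v(2) by metis
    then have "sq_norm ?\<Omega> v \<noteq> 0" unfolding inner_on_self sq_norm_def by (simp only: of_real_eq_0_iff) simp
    then have pos: "sq_norm ?\<Omega> v > 0" by (simp add: less_le sq_norm_def sum_nonneg)
    have "(x j)\<^sup>2 * sq_norm ?\<Omega> v = sq_norm ?\<Omega> (shift_op d k Q j v)"
      unfolding e by (simp add: sq_norm_def cscale_def norm_mult power_mult_distrib sum_distrib_left)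
    also have "\<dots> \<le> (op_norm d Q)\<^sup>2 * sq_norm ?\<Omega> v"
      by (rule sq_norm_shift_op[OF op_norm_bound[OF Qc] k d xj(2)])
    finally have "(x j)\<^sup>2 \<le> (op_norm d Q)\<^sup>2" using pos by simp
    then show "\<bar>x j\<bar> \<le> op_norm d Q" using op_norm_nonneg[OF Qc] by (simp add: abs_le_square_iff[symmetric])
  next
    fix \<rho> :: "complex mat" and j assume \<rho>: "\<rho> \<in> carrier_mat d d" "(\<Sum>a<d. \<rho> $$ (a, a)) = 1" and j: "0 < j" "j \<le> k"
    let ?A = "shift_op d k Q j" and ?R = "\<lambda>g f. \<Prod>t<k. \<rho> $$ (g t, f t)"
    define \<delta> :: "(nat \<Rightarrow> nat) \<Rightarrow> (nat \<Rightarrow> nat) \<Rightarrow> complex" where "\<delta> = (\<lambda>g f. if f = g then 1 else 0)"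
    have j': "j < Suc k" using j by simp
    \<comment> \<open>Completeness of the projections, applied to a basis vector, yields the
      spectral resolution of the shift operator: its columns are the sums of \<open>x j\<close>
      times those of \<open>P x\<close>.\<close>
    have "(\<Sum>x\<in>X. (\<lambda>f. P x f g)) = \<delta> g" if g: "g \<in> ?\<Omega>" for g
    proof
      fix f show "(\<Sum>x\<in>X. (\<lambda>f. P x f g)) f = \<delta> g f"
      proof (cases "f \<in> ?\<Omega>")
        case False
        then have "P x f g = 0" if "x \<in> X" for x using supp[OF that g] by (simp add: supp_on_def)
        then show ?thesis using False g by (auto simp: sum_fun_apply \<delta>_def)
      qed (simp add: sum_fun_apply \<delta>_def res g)
    qed
    then have A\<delta>: "(\<Sum>x\<in>X. complex_of_real (x j) * P x f g) = ?A (\<delta> g) f" if "g \<in> ?\<Omega>" for f g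
      using that linop_sum[OF lin[OF j'], of "\<lambda>x f. P x f g" X]
      by (simp add: Peig[OF _ that j'] sum_fun_apply cscale_def cong: sum.cong)
    have st: "state_fun d k \<rho> f = (\<Sum>g\<in>?\<Omega>. cscale (?R g f) (\<delta> g))" for f
    proof
      fix h
      have "(\<Sum>g\<in>?\<Omega>. ?R g f * \<delta> g h) = (\<Sum>g\<in>?\<Omega>. if g = h then ?R g f else 0)"
        by (intro sum.cong) (auto simp: \<delta>_def)
      then show "state_fun d k \<rho> f h = (\<Sum>g\<in>?\<Omega>. cscale (?R g f) (\<delta> g)) h"
        by (simp add: sum_fun_apply cscale_def state_fun_def)
    qed
    have "(\<Sum>x\<in>X. complex_of_real (x j) * (\<Sum>f\<in>?\<Omega>. \<Sum>g\<in>?\<Omega>. P x f g * ?R g f))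
        = (\<Sum>f\<in>?\<Omega>. \<Sum>g\<in>?\<Omega>. ?R g f * (\<Sum>x\<in>X. complex_of_real (x j) * P x f g))"
      unfolding sum_distrib_left
      by (subst sum.swap, rule sum.cong[OF refl], subst sum.swap) (simp add: mult_ac)
    also have "\<dots> = (\<Sum>f\<in>?\<Omega>. \<Sum>g\<in>?\<Omega>. ?R g f * ?A (\<delta> g) f)"
      by (simp only: A\<delta> cong: sum.cong)
    also have "\<dots> = (\<Sum>f\<in>?\<Omega>. ?A (state_fun d k \<rho> f) f)"
      unfolding st by (simp only: linop_sum[OF lin[OF j']] linop_cscale[OF lin[OF j']] sum_fun_apply) (simp add: cscale_def)
    also have "\<dots> = mtrace (Q * \<rho> ^\<^sub>m j)" by (rule shift_op_trace[OF \<rho>(1) Qc \<rho>(2) j])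
    finally show "(\<Sum>x\<in>X. complex_of_real (x j) * block_prob d k P \<rho> x) = mtrace (Q * \<rho> ^\<^sub>m j)"
      unfolding block_prob_def .
  qed (fact X res gram)+
qed

section \<open>Gram forms and positivity\<close>

lemma sum_swap3:
  "(\<Sum>g\<in>G. \<Sum>h\<in>H. \<Sum>w\<in>W. T g h w) = (\<Sum>h\<in>H. \<Sum>w\<in>W. \<Sum>g\<in>G. T g h w)"
  by (subst sum.swap, rule sum.cong[OF refl], rule sum.swap)

text \<open>With \<open>P = B\<^sup>* B\<close> and \<open>R = C\<^sup>* C\<close>, the trace of
  \<open>P R\<close> is the squared Hilbert-Schmidt norm of \<open>B C\<^sup>*\<close>.\<close>

lemma gram_pairing_nonneg:
  fixes R :: "'i \<Rightarrow> 'i \<Rightarrow> complex"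
  assumes "\<And>f g. f \<in> \<Omega> \<Longrightarrow> g \<in> \<Omega> \<Longrightarrow> P f g = (\<Sum>h\<in>H. cnj (B h f) * B h g)"
    and "\<And>f g. f \<in> \<Omega> \<Longrightarrow> g \<in> \<Omega> \<Longrightarrow> R g f = (\<Sum>w\<in>W. cnj (C w g) * C w f)"
  shows "(\<Sum>f\<in>\<Omega>. \<Sum>g\<in>\<Omega>. P f g * R g f) \<in> \<real>" "0 \<le> Re (\<Sum>f\<in>\<Omega>. \<Sum>g\<in>\<Omega>. P f g * R g f)"
proof -
  have "(\<Sum>f\<in>\<Omega>. \<Sum>g\<in>\<Omega>. P f g * R g f) = (\<Sum>f\<in>\<Omega>. \<Sum>g\<in>\<Omega>. \<Sum>h\<in>H. \<Sum>w\<in>W. cnj (B h f) * C w f * (B h g * cnj (C w g)))"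
    by (intro sum.cong refl) (simp add: assms sum_product mult_ac)
  also have "\<dots> = (\<Sum>h\<in>H. \<Sum>w\<in>W. \<Sum>f\<in>\<Omega>. \<Sum>g\<in>\<Omega>. cnj (B h f) * C w f * (B h g * cnj (C w g)))"
    by (subst sum_swap3[of _ _ _ \<Omega>], rule sum_swap3)
  also have "\<dots> = (\<Sum>h\<in>H. \<Sum>w\<in>W. complex_of_real ((cmod (\<Sum>f\<in>\<Omega>. cnj (B h f) * C w f))\<^sup>2))"
  proof (intro sum.cong refl)
    fix h w
    let ?z = "\<Sum>f\<in>\<Omega>. cnj (B h f) * C w f"
    have "(\<Sum>f\<in>\<Omega>. \<Sum>g\<in>\<Omega>. cnj (B h f) * C w f * (B h g * cnj (C w g))) = ?z * cnj ?z"
      by (simp add: sum_product cnj_sum)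
    then show "(\<Sum>f\<in>\<Omega>. \<Sum>g\<in>\<Omega>. cnj (B h f) * C w f * (B h g * cnj (C w g))) = complex_of_real ((cmod ?z)\<^sup>2)"
      by (simp only: complex_norm_square)
  qed
  also have "\<dots> = complex_of_real (\<Sum>h\<in>H. \<Sum>w\<in>W. (cmod (\<Sum>f\<in>\<Omega>. cnj (B h f) * C w f))\<^sup>2)" by simp
  finally have eq: "(\<Sum>f\<in>\<Omega>. \<Sum>g\<in>\<Omega>. P f g * R g f) = \<dots>" .
  show "(\<Sum>f\<in>\<Omega>. \<Sum>g\<in>\<Omega>. P f g * R g f) \<in> \<real>" unfolding eq by (rule Reals_of_real)
  show "0 \<le> Re (\<Sum>f\<in>\<Omega>. \<Sum>g\<in>\<Omega>. P f g * R g f)" unfolding eq by (simp add: sum_nonneg)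
qed

definition matop :: "nat \<Rightarrow> complex mat \<Rightarrow> (nat \<Rightarrow> complex) \<Rightarrow> nat \<Rightarrow> complex" where
  "matop d \<rho> v = (\<lambda>a. if a < d then \<Sum>b<d. \<rho> $$ (a, b) * v b else 0)"

lemma linop_matop: "linop (matop d \<rho>)"
  by (auto simp: linop_def matop_def cscale_def fun_eq_iff sum.distrib sum_distrib_left algebra_simps)

lemma selfadj_matop:
  assumes "hermitian_mat d \<rho>"
  shows "selfadj {..<d} (matop d \<rho>)"
proof -
  have "inner_on {..<d} u (matop d \<rho> v) = inner_on {..<d} (matop d \<rho> u) v" for u v
  proof -
    have "inner_on {..<d} u (matop d \<rho> v) = (\<Sum>a<d. \<Sum>b<d. cnj (u a) * (\<rho> $$ (a, b) * v b))"
      by (simp add: inner_on_def matop_def sum_distrib_left)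
    also have "\<dots> = (\<Sum>a<d. \<Sum>b<d. cnj (\<rho> $$ (b, a) * u a) * v b)"
    proof (intro sum.cong refl)
      fix a b assume "a \<in> {..<d}" "b \<in> {..<d}"
      then have "\<rho> $$ (a, b) = cnj (\<rho> $$ (b, a))" by (intro hermitian_matD[OF assms]) simp_all
      then show "cnj (u a) * (\<rho> $$ (a, b) * v b) = cnj (\<rho> $$ (b, a) * u a) * v b" by simp
    qed
    also have "\<dots> = (\<Sum>b<d. \<Sum>a<d. cnj (\<rho> $$ (b, a) * u a) * v b)" by (rule sum.swap)
    also have "\<dots> = inner_on {..<d} (matop d \<rho> u) v"
      by (simp add: inner_on_def matop_def sum_distrib_right)
    finally show ?thesis .
  qed
  then show ?thesis using linop_matop[of d \<rho>]
    by (auto simp: selfadj_def supp_on_def matop_def)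
qed

text \<open>The spectral measure of a single operator is reused: its eigenvalues are nonnegative by
  testing positivity on eigenvectors, and the projections scaled by their square roots supply the
  Gram vectors.\<close>

lemma psd_gram:
  assumes psd: "psd_mat d \<rho>"
  obtains W :: "((nat \<Rightarrow> real) \<times> nat) set" and C where "finite W"
    "\<And>a b. a < d \<Longrightarrow> b < d \<Longrightarrow> \<rho> $$ (a, b) = (\<Sum>w\<in>W. cnj (C w a) * C w b)"
proof -
  have herm: "hermitian_mat d \<rho>" using psd by (simp add: psd_mat_def)
  obtain X :: "(nat \<Rightarrow> real) set" and P where
    X: "finite X" and
    eig: "\<And>x. x \<in> X \<Longrightarrow> \<exists>v\<in>supp_on {..<d}. v \<noteq> 0 \<and> (\<forall>j<Suc 0. matop d \<rho> v = cscale (x j) v)" and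
    res: "\<And>f g. f \<in> {..<d} \<Longrightarrow> g \<in> {..<d} \<Longrightarrow> (\<Sum>x\<in>X. P x f g) = (if f = g then 1 else 0)" and
    gram: "\<And>x f g. x \<in> X \<Longrightarrow> f \<in> {..<d} \<Longrightarrow> g \<in> {..<d} \<Longrightarrow> P x f g = (\<Sum>h<d. cnj (P x h f) * P x h g)" and
    supp: "\<And>x g. x \<in> X \<Longrightarrow> g \<in> {..<d} \<Longrightarrow> (\<lambda>f. P x f g) \<in> supp_on {..<d}" and
    Peig: "\<And>x g j. x \<in> X \<Longrightarrow> g \<in> {..<d} \<Longrightarrow> j < Suc 0 \<Longrightarrow> matop d \<rho> (\<lambda>f. P x f g) = cscale (x j) (\<lambda>f. P x f g)"
    by (rule joint_spectral_measure[where A = "\<lambda>_. matop d \<rho>" and n = "Suc 0",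
          OF finite_lessThan selfadj_matop[OF herm] refl])
       (rule that; assumption)
  have nonneg: "x 0 \<ge> 0" if x: "x \<in> X" for x
  proof -
    obtain v where v: "v \<in> supp_on {..<d}" "v \<noteq> 0" "\<forall>j<Suc 0. matop d \<rho> v = cscale (x j) v"
      using eig[OF x] by (elim bexE conjE)
    have e: "matop d \<rho> v = cscale (x 0) v" using v(3) by simp
    have n0: "inner_on {..<d} v v \<noteq> 0" using inner_on_self_zero[OF finite_lessThan v(1)] v(2) by metis
    have "0 \<le> Re (\<Sum>i<d. \<Sum>j<d. cnj (vec_index (Matrix.vec d v) i) * \<rho> $$ (i, j) * vec_index (Matrix.vec d v) j)"
      by (rule bspec[OF conjunct2[OF psd[unfolded psd_mat_def]]]) simp
    also have "(\<Sum>i<d. \<Sum>j<d. cnj (vec_index (Matrix.vec d v) i) * \<rho> $$ (i, j) * vec_index (Matrix.vec d v) j)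
      = inner_on {..<d} v (matop d \<rho> v)"
      by (simp add: inner_on_def matop_def sum_distrib_left mult.assoc)
    also have "\<dots> = complex_of_real (x 0 * (\<Sum>i<d. (cmod (v i))\<^sup>2))"
      unfolding e inner_on_cscale_right inner_on_self by simp
    finally have "0 \<le> x 0 * (\<Sum>i<d. (cmod (v i))\<^sup>2)" by simp
    moreover have "(\<Sum>i<d. (cmod (v i))\<^sup>2) > 0"
      using n0 unfolding inner_on_self by (simp only: of_real_eq_0_iff) (simp add: less_le sum_nonneg)
    ultimately show ?thesis by (simp add: zero_le_mult_iff)
  qed
  define C where "C = (\<lambda>(x, h) a. complex_of_real (sqrt (x 0)) * P x h a)"
  show thesis
  proof (rule that[of "X \<times> {..<d}" C])
    fix a b assume ab: "a < d" "b < d"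
    define \<delta> :: "nat \<Rightarrow> complex" where "\<delta> = (\<lambda>f. if f = b then 1 else 0)"
    have "(\<Sum>x\<in>X. (\<lambda>f. P x f b)) = \<delta>"
    proof
      fix f show "(\<Sum>x\<in>X. (\<lambda>f. P x f b)) f = \<delta> f"
      proof (cases "f < d")
        case False
        then have "P x f b = 0" if "x \<in> X" for x using supp[OF that] ab by (simp add: supp_on_def)
        then show ?thesis using False ab by (auto simp: sum_fun_apply \<delta>_def)
      qed (use ab res in \<open>simp add: sum_fun_apply \<delta>_def\<close>)
    qed
    then have "matop d \<rho> \<delta> a = (\<Sum>x\<in>X. matop d \<rho> (\<lambda>f. P x f b)) a"
      using linop_sum[OF linop_matop[of d \<rho>], of "\<lambda>x f. P x f b" X] by simp
    also have "\<dots> = (\<Sum>x\<in>X. x 0 * P x a b)"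
      unfolding sum_fun_apply using Peig ab by (intro sum.cong refl) (simp add: cscale_def)
    also have "\<dots> = (\<Sum>x\<in>X. \<Sum>h<d. cnj (C (x, h) a) * C (x, h) b)"
    proof (rule sum.cong[OF refl])
      fix x assume x: "x \<in> X"
      have sq: "complex_of_real (sqrt (x 0)) * complex_of_real (sqrt (x 0)) = x 0"
        unfolding of_real_mult[symmetric] using nonneg[OF x] by simp
      have "x 0 * P x a b = (\<Sum>h<d. x 0 * (cnj (P x h a) * P x h b))"
        unfolding sum_distrib_left[symmetric]
        by (rule arg_cong[where f = "(*) _"], rule gram[OF x]) (use ab in simp_all)
      also have "\<dots> = (\<Sum>h<d. cnj (C (x, h) a) * C (x, h) b)"
        unfolding C_def sq[symmetric] by (intro sum.cong refl) simp
      finally show "x 0 * P x a b = (\<Sum>h<d. cnj (C (x, h) a) * C (x, h) b)" .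
    qed
    also have "matop d \<rho> \<delta> a = \<rho> $$ (a, b)"
      using ab by (simp add: matop_def \<delta>_def if_distrib cong: if_cong)
    finally show "\<rho> $$ (a, b) = (\<Sum>w\<in>X \<times> {..<d}. cnj (C w a) * C w b)"
      by (simp add: sum.cartesian_product)
  qed (use X in simp)
qed

section \<open>Concentration of the empirical means\<close>

text \<open>Hoeffding's inequality for each \<open>j\<close>, then a union bound over
  \<open>J\<close>. The success probability is a finite sum over outcome sequences because the Born
  rule delivers it in that form.\<close>

lemma iid_mean_concentration:
  fixes q :: "'a \<Rightarrow> real" and y :: "'b \<Rightarrow> 'a \<Rightarrow> real"
  assumes X: "finite X" and q: "\<And>x. x \<in> X \<Longrightarrow> 0 \<le> q x" "(\<Sum>x\<in>X. q x) = 1"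
    and J: "finite J" and y: "\<And>j x. j \<in> J \<Longrightarrow> x \<in> X \<Longrightarrow> \<bar>y j x\<bar> \<le> M"
    and M: "0 < M" and T: "0 < T" and \<epsilon>: "0 < \<epsilon>"
  shows "1 - card J * (2 * exp (- (real T * \<epsilon>\<^sup>2 / (2 * M\<^sup>2)))) \<le>
    (\<Sum>xs\<in>{xs \<in> PiE {..<T} (\<lambda>_. X). \<forall>j\<in>J. \<bar>(\<Sum>s<T. y j (xs s)) / real T - (\<Sum>x\<in>X. q x * y j x)\<bar> \<le> \<epsilon>}.
       \<Prod>s<T. q (xs s))"
proof -
  define p where "p = embed_pmf (\<lambda>x. if x \<in> X then q x else 0)"
  have "(\<integral>\<^sup>+ x. ennreal (if x \<in> X then q x else 0) \<partial>count_space UNIV) = (\<Sum>x\<in>X. ennreal (q x))"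
    using X by (subst nn_integral_count_space'[of X]) auto
  also have "\<dots> = 1" using q by (simp add: sum_ennreal)
  finally have pmf: "pmf p x = (if x \<in> X then q x else 0)" for x
    unfolding p_def using q by (subst pmf_embed_pmf) auto
  have set_p: "set_pmf p \<subseteq> X" by (auto simp: set_pmf_eq pmf split: if_splits)
  \<comment> \<open>The default \<open>undefined\<close> matches the extensional functions of
    \<open>PiE\<close>.\<close>
  define R where "R = Pi_pmf {..<T} undefined (\<lambda>_. p)"
  have set_R: "set_pmf R \<subseteq> PiE {..<T} (\<lambda>_. X)"
    using set_p by (auto simp: R_def set_Pi_pmf PiE_dflt_def PiE_def extensional_def)
  have pmf_R: "pmf R xs = (\<Prod>s<T. q (xs s))" if "xs \<in> PiE {..<T} (\<lambda>_. X)" for xs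
    unfolding R_def using that
    by (subst pmf_Pi) (auto simp: pmf PiE_def extensional_def Pi_def intro!: prod.cong)
  define bad where "bad = (\<lambda>j. {xs. \<bar>(\<Sum>s<T. y j (xs s)) / real T - (\<Sum>x\<in>X. q x * y j x)\<bar> > \<epsilon>})"
  have bad: "measure_pmf.prob R (bad j) \<le> 2 * exp (- (real T * \<epsilon>\<^sup>2 / (2 * M\<^sup>2)))" if j: "j \<in> J" for j
  proof -
    have E: "measure_pmf.expectation R (\<lambda>f. y j (f s)) = (\<Sum>x\<in>X. q x * y j x)" if "s < T" for s
    proof -
      have "measure_pmf.expectation R (\<lambda>f. y j (f s)) = measure_pmf.expectation (map_pmf (\<lambda>f. f s) R) (y j)"
        by simp
      also have "map_pmf (\<lambda>f. f s) R = p" unfolding R_def using that by (subst Pi_pmf_component) auto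
      also have "measure_pmf.expectation p (y j) = (\<Sum>x\<in>X. y j x * pmf p x)"
        using set_p X by (intro integral_measure_pmf_real) auto
      finally show ?thesis by (simp add: pmf mult.commute)
    qed
    have "prob_space.indep_vars (measure_pmf R) (\<lambda>_. borel) (\<lambda>s f. y j (f s)) {..<T}"
      unfolding R_def
      by (rule prob_space.indep_vars_compose2[OF measure_pmf.prob_space_axioms indep_vars_Pi_pmf, where Y = "\<lambda>_. y j"]) auto
    moreover have "AE f in measure_pmf R. y j (f s) \<in> {-M..M}" if "s \<in> {..<T}" for s
      unfolding AE_measure_pmf_iff
    proof
      fix f assume "f \<in> set_pmf R"
      then have "f s \<in> X" using set_R that by (auto simp: PiE_def Pi_def)
      then show "y j (f s) \<in> {-M..M}" using y[OF j, of "f s"] by auto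
    qed
    ultimately interpret H: Hoeffding_ineq "measure_pmf R" "{..<T}" "\<lambda>s f. y j (f s)" "\<lambda>_. -M" "\<lambda>_. M"
      "\<Sum>s<T. measure_pmf.expectation R (\<lambda>f. y j (f s))"
      by unfold_locales auto
    have "bad j \<subseteq> {f \<in> space (measure_pmf R). \<bar>(\<Sum>s<T. y j (f s)) -
        (\<Sum>s<T. measure_pmf.expectation R (\<lambda>f. y j (f s)))\<bar> \<ge> real T * \<epsilon>}"
    proof
      fix f assume "f \<in> bad j"
      then have "real T * \<epsilon> \<le> real T * \<bar>(\<Sum>s<T. y j (f s)) / real T - (\<Sum>x\<in>X. q x * y j x)\<bar>"
        using T by (simp add: bad_def)
      also have "\<dots> = \<bar>real T * ((\<Sum>s<T. y j (f s)) / real T - (\<Sum>x\<in>X. q x * y j x))\<bar>"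
        by (simp add: abs_mult)
      also have "real T * ((\<Sum>s<T. y j (f s)) / real T - (\<Sum>x\<in>X. q x * y j x))
          = (\<Sum>s<T. y j (f s)) - (\<Sum>s<T. measure_pmf.expectation R (\<lambda>f. y j (f s)))"
        using T by (simp add: E right_diff_distrib)
      finally show "f \<in> {f \<in> space (measure_pmf R). \<bar>(\<Sum>s<T. y j (f s)) -
        (\<Sum>s<T. measure_pmf.expectation R (\<lambda>f. y j (f s)))\<bar> \<ge> real T * \<epsilon>}" by simp
    qed
    then have "measure_pmf.prob R (bad j) \<le> measure_pmf.prob R {f \<in> space (measure_pmf R). \<bar>(\<Sum>s<T. y j (f s)) -
        (\<Sum>s<T. measure_pmf.expectation R (\<lambda>f. y j (f s)))\<bar> \<ge> real T * \<epsilon>}"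
      by (intro measure_pmf.finite_measure_mono) auto
    also have "\<dots> \<le> 2 * exp (- 2 * (real T * \<epsilon>)\<^sup>2 / (\<Sum>s<T. (M - - M)\<^sup>2))"
      using \<epsilon> T M by (intro H.Hoeffding_ineq_abs_ge) auto
    \<comment> \<open>Each of the \<open>T\<close> variables ranges over an interval of length
      \<open>2 * M\<close>, so the denominator is \<open>4 * T * M\<^sup>2\<close>.\<close>
    also have "- 2 * (real T * \<epsilon>)\<^sup>2 / (\<Sum>s<T. (M - - M)\<^sup>2) = - (real T * \<epsilon>\<^sup>2 / (2 * M\<^sup>2))"
      using T M by (simp add: power2_eq_square field_simps)
    finally show ?thesis .
  qed
  let ?G = "{xs \<in> PiE {..<T} (\<lambda>_. X). \<forall>j\<in>J. \<bar>(\<Sum>s<T. y j (xs s)) / real T - (\<Sum>x\<in>X. q x * y j x)\<bar> \<le> \<epsilon>}"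
  have finG: "finite ?G" 
    by (rule finite_subset[OF _ finite_PiE[of "{..<T}" "\<lambda>_. X"]]) (use X in auto)
  define S where "S = ?G \<union> (\<Union>j\<in>J. bad j)"
  have "set_pmf R \<subseteq> S"
  proof
    fix xs assume "xs \<in> set_pmf R"
    then have "xs \<in> PiE {..<T} (\<lambda>_. X)" using set_R by blast
    then show "xs \<in> S" unfolding S_def bad_def by (simp add: not_less) (metis not_less)
  qed
  then have "measure_pmf.prob R S = 1"
    by (subst measure_pmf.prob_eq_1) (simp_all add: AE_measure_pmf_iff subset_iff)
  then have "1 \<le> measure_pmf.prob R (?G \<union> (\<Union>j\<in>J. bad j))" unfolding S_def by simp
  also have "\<dots> \<le> measure_pmf.prob R ?G + measure_pmf.prob R (\<Union>j\<in>J. bad j)"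
    by (intro measure_Un_le) auto
  also have "measure_pmf.prob R (\<Union>j\<in>J. bad j) \<le> (\<Sum>j\<in>J. measure_pmf.prob R (bad j))"
    using J by (intro measure_pmf.finite_measure_subadditive_finite) auto
  also have "\<dots> \<le> card J * (2 * exp (- (real T * \<epsilon>\<^sup>2 / (2 * M\<^sup>2))))"
    using bad by (rule sum_bounded_above)
  also have "measure_pmf.prob R ?G = (\<Sum>xs\<in>?G. \<Prod>s<T. q (xs s))"
    using finG by (subst measure_measure_pmf_finite) (auto intro!: sum.cong simp: pmf_R)
  finally show ?thesis by simp
qed

section \<open>Digit expansions and tensor powers\<close>

text \<open>The \<open>s\<close>-th block of \<open>k\<close> digits of \<open>i\<close> in base \<open>d\<close>. Digit \<open>0\<close> is the least significant one, whereas
  the first factor of \<^const>\<open>kron\<close> is the most significant; on powers of a single state the order is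
  irrelevant.\<close>

definition digit_block :: "nat \<Rightarrow> nat \<Rightarrow> nat \<Rightarrow> nat \<Rightarrow> nat \<Rightarrow> nat" where
  "digit_block d k s i = (\<lambda>t. if t < k then (i div d ^ (s * k + t)) mod d else 0)"

lemma digit_block_in_configs: "0 < d \<Longrightarrow> digit_block d k s i \<in> configs d k"
  by (simp add: digit_block_def configs_def)

lemma digit_add_low:
  fixes d :: nat
  assumes "t < n" "0 < d"
  shows "(a * d ^ n + r) div d ^ t mod d = r div d ^ t mod d"
proof -
  have "n = t + Suc (n - Suc t)" using assms by simp
  then have "d ^ n = d ^ t * (d * d ^ (n - Suc t))" by (metis power_Suc power_add)
  then have "(a * d ^ n + r) div d ^ t = (r + (a * (d * d ^ (n - Suc t))) * d ^ t) div d ^ t"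
    by (simp add: mult_ac add.commute)
  also have "\<dots> = a * (d * d ^ (n - Suc t)) + r div d ^ t"
    using assms by (subst div_mult_self1) auto
  also have "\<dots> mod d = r div d ^ t mod d"
    by (metis mod_mult_self3 mult.assoc mult.commute)
  finally show ?thesis .
qed

lemma digit_add_high:
  fixes d :: nat
  assumes "r < d ^ n"
  shows "(a * d ^ n + r) div d ^ (n + t) = a div d ^ t"
proof -
  have "(a * c + r) div c = a" if "r < c" for c using that by simp
  from this[OF assms] show ?thesis by (simp only: power_add div_mult2_eq)
qed

lemma sum_lessThan_mult:
  fixes F :: "nat \<Rightarrow> 'a :: comm_monoid_add"
  shows "(\<Sum>i<n * m. F i) = (\<Sum>a<n. \<Sum>r<m. F (a * m + r))"
  unfolding sum.nat_group[symmetric]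
  by (rule sum.cong[OF refl], subst sum.atLeastLessThan_shift_0) (simp add: lessThan_atLeast0)

lemma prod_lessThan_mult:
  fixes F :: "nat \<Rightarrow> 'a :: comm_monoid_mult"
  shows "(\<Prod>i<n * m. F i) = (\<Prod>a<n. \<Prod>r<m. F (a * m + r))"
  unfolding prod.nat_group[symmetric]
  by (rule prod.cong[OF refl], subst prod.atLeastLessThan_shift_0) (simp add: lessThan_atLeast0)

text \<open>Digit expansion identifies matrix indices with configurations. The most significant
  digit becomes the entry at the new last position.\<close>

lemma sum_digits:
  assumes "0 < d"
  shows "(\<Sum>i<d ^ k. F (digit_block d k 0 i)) = (\<Sum>f\<in>configs d k. F f)"
proof (induction k arbitrary: F)
  case 0
  then show ?case by (simp add: digit_block_def)
next
  case (Suc k)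
  have "digit_block d (Suc k) 0 (a * d ^ k + r) = (digit_block d k 0 r)(k := a)" if "a < d" "r < d ^ k" for a r
  proof
    fix t show "digit_block d (Suc k) 0 (a * d ^ k + r) t = ((digit_block d k 0 r)(k := a)) t"
      using that digit_add_low[of t k d a r] digit_add_high[of r d k a 0] assms
      by (auto simp: digit_block_def less_Suc_eq)
  qed
  then have "(\<Sum>i<d ^ Suc k. F (digit_block d (Suc k) 0 i)) = (\<Sum>a<d. \<Sum>r<d ^ k. F ((digit_block d k 0 r)(k := a)))"
    by (simp add: sum_lessThan_mult)
  also have "\<dots> = (\<Sum>f\<in>configs d (Suc k). F f)"
    unfolding sum_configs_Suc by (subst sum.swap) (rule Suc)
  finally show ?case .
qed

text \<open>The distributive law across batches: sums over indices of the full system factor into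
  sums over single-batch configurations. It reduces Gram forms and Born probabilities to one
  batch.\<close>

lemma sum_blocks:
  fixes h :: "nat \<Rightarrow> (nat \<Rightarrow> nat) \<Rightarrow> 'a :: comm_semiring_1"
  assumes d: "0 < d"
  shows "(\<Sum>i<d ^ (T * k). \<Prod>s<T. h s (digit_block d k s i)) = (\<Prod>s<T. \<Sum>f\<in>configs d k. h s f)"
proof (induction T)
  case (Suc T)
  let ?D = "d ^ (T * k)"
  have low: "digit_block d k s (a * ?D + r) = digit_block d k s r" if "s < T" for s a r
  proof
    fix t
    have "s * k + t < T * k" if "t < k"
    proof -
      have "s * k + t < Suc s * k" using that by simp
      also have "\<dots> \<le> T * k" using \<open>s < T\<close> by (intro mult_le_mono1) simp
      finally show ?thesis .
    qed
    then show "digit_block d k s (a * ?D + r) t = digit_block d k s r t"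
      using digit_add_low[OF _ d] by (simp add: digit_block_def)
  qed
  have high: "digit_block d k T (a * ?D + r) = digit_block d k 0 a" if "r < ?D" for a r
    using digit_add_high[OF that] by (simp add: digit_block_def fun_eq_iff)
  have "(\<Sum>i<d ^ (Suc T * k). \<Prod>s<Suc T. h s (digit_block d k s i))
      = (\<Sum>a<d ^ k. \<Sum>r<?D. (\<Prod>s<T. h s (digit_block d k s r)) * h T (digit_block d k 0 a))"
    by (simp add: power_add sum_lessThan_mult low high)
  also have "\<dots> = (\<Sum>r<?D. \<Prod>s<T. h s (digit_block d k s r)) * (\<Sum>a<d ^ k. h T (digit_block d k 0 a))"
    by (subst sum.swap) (simp add: sum_product)
  finally show ?case using Suc sum_digits[OF d, of "h T" k] by simp
qed simp

section \<open>Entries of tensor powers and separation of indices by digits\<close>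

lemma tensor_pow_carrier: "\<rho> \<in> carrier_mat d d \<Longrightarrow> tensor_pow \<rho> m \<in> carrier_mat (d ^ m) (d ^ m)"
  by (induction m) (auto simp: kron_def)

lemma tensor_pow_index:
  assumes \<rho>: "\<rho> \<in> carrier_mat d d" and d: "0 < d"
  shows "i < d ^ m \<Longrightarrow> j < d ^ m \<Longrightarrow>
    tensor_pow \<rho> m $$ (i, j) = (\<Prod>t<m. \<rho> $$ (i div d ^ t mod d, j div d ^ t mod d))"
proof (induction m arbitrary: i j)
  case (Suc m)
  have dig: "(i mod d ^ m) div d ^ t mod d = i div d ^ t mod d" if "t < m" for i t
    by (metis digit_add_low[OF that d] div_mult_mod_eq)
  have lt: "i div d ^ m < d" "j div d ^ m < d"
    using Suc.prems by (auto simp: less_mult_imp_div_less)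
  have "tensor_pow \<rho> (Suc m) $$ (i, j) =
      \<rho> $$ (i div d ^ m, j div d ^ m) * tensor_pow \<rho> m $$ (i mod d ^ m, j mod d ^ m)"
    using Suc.prems \<rho> tensor_pow_carrier[OF \<rho>, of m] by (simp add: kron_def)
  also have "tensor_pow \<rho> m $$ (i mod d ^ m, j mod d ^ m) = (\<Prod>t<m. \<rho> $$ (i div d ^ t mod d, j div d ^ t mod d))"
    using d by (simp add: Suc.IH dig)
  finally show ?case using lt by (simp add: mult.commute)
qed simp

lemma tensor_pow_blocks:
  assumes "\<rho> \<in> carrier_mat d d" "0 < d" "i < d ^ (T * k)" "j < d ^ (T * k)"
  shows "tensor_pow \<rho> (T * k) $$ (i, j) = (\<Prod>s<T. \<Prod>t<k. \<rho> $$ (digit_block d k s i t, digit_block d k s j t))"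
  unfolding tensor_pow_index[OF assms] prod_lessThan_mult
  by (intro prod.cong refl) (simp add: digit_block_def)

lemma digits_inj:
  fixes d :: nat
  assumes "0 < d"
  shows "i < d ^ m \<Longrightarrow> j < d ^ m \<Longrightarrow> (\<And>t. t < m \<Longrightarrow> i div d ^ t mod d = j div d ^ t mod d) \<Longrightarrow> i = j"
proof (induction m arbitrary: i j)
  case (Suc m)
  have dig: "(i mod d ^ m) div d ^ t mod d = i div d ^ t mod d" if "t < m" for i t
    by (metis digit_add_low[OF that assms] div_mult_mod_eq)
  have "i mod d ^ m = j mod d ^ m"
  proof (rule Suc.IH)
    fix t assume "t < m"
    then show "i mod d ^ m div d ^ t mod d = j mod d ^ m div d ^ t mod d"
      unfolding dig[OF \<open>t < m\<close>] by (intro Suc.prems(3)) simp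
  qed (use assms in simp_all)
  moreover have "i div d ^ m < d" "j div d ^ m < d"
    using Suc.prems by (auto simp: less_mult_imp_div_less)
  then have "i div d ^ m = j div d ^ m" using Suc.prems(3)[of m] by simp
  ultimately show ?case by (metis div_mult_mod_eq)
qed simp

text \<open>Digit \<open>t\<close> is found in block \<open>t div k\<close> at position
  \<open>t mod k\<close>. Distinct indices therefore differ in some batch, which makes the
  off-diagonal entries of the summed effects vanish.\<close>

lemma digit_block_inj:
  assumes d: "0 < d" and "i < d ^ (T * k)" "j < d ^ (T * k)" and eq: "\<And>s. s < T \<Longrightarrow> digit_block d k s i = digit_block d k s j"
  shows "i = j"
proof (rule digits_inj[OF d assms(2,3)])
  fix t assume t: "t < T * k"
  then have k: "0 < k" by (cases k) auto
  have "t div k < T" using t by (simp add: less_mult_imp_div_less)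
  from fun_cong[OF eq[OF this], of "t mod k"] k
  show "i div d ^ t mod d = j div d ^ t mod d" by (simp add: digit_block_def)
qed

lemma psd_mat_gram:
  assumes L: "finite L" and A: "\<And>i j. i < N \<Longrightarrow> j < N \<Longrightarrow> A $$ (i, j) = (\<Sum>l\<in>L. cnj (B l i) * B l j)"
    and "A \<in> carrier_mat N N"
  shows "psd_mat N A"
proof -
  have "A $$ (i, j) = cnj (A $$ (j, i))" if "i < N" "j < N" for i j
    unfolding A[OF that] A[OF that(2,1)] by (simp add: mult.commute)
  moreover have "0 \<le> Re (\<Sum>i<N. \<Sum>j<N. cnj (vec_index v i) * A $$ (i, j) * vec_index v j)" for v
  proof -
    \<comment> \<open>The quadratic form is the trace pairing of \<open>A\<close> with the rank-one
      matrix \<open>v v\<^sup>*\<close>, whose Gram form has a single row.\<close>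
    have "0 \<le> Re (\<Sum>i<N. \<Sum>j<N. A $$ (i, j) * (vec_index v j * cnj (vec_index v i)))"
      by (rule gram_pairing_nonneg(2)[where H = L and B = B and W = "{()}" and C = "\<lambda>_ i. cnj (vec_index v i)"])
         (use A in auto)
    then show ?thesis by (simp add: mult_ac)
  qed
  ultimately show ?thesis using assms(3) by (simp only: psd_mat_def hermitian_mat_def) blast
qed

section \<open>Product measurements\<close>

lemma mtrace_mult:
  assumes "A \<in> carrier_mat N N" "B \<in> carrier_mat N N"
  shows "mtrace (A * B) = (\<Sum>i<N. \<Sum>j<N. A $$ (i, j) * B $$ (j, i))"
proof -
  have "mtrace (A * B) = (\<Sum>i<N. (A * B) $$ (i, i))" using assms by (simp add: mtrace_def)
  also have "\<dots> = (\<Sum>i<N. \<Sum>j<N. A $$ (i, j) * B $$ (j, i))"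
    using index_mult_mat_sum[OF assms] by (intro sum.cong refl) simp
  finally show ?thesis .
qed

text \<open>Entry \<open>(i, j)\<close> of the tensor product of the projections
  \<open>P (xs s)\<close> over the batches.\<close>

definition block_effect where
  "block_effect d k T P xs i j = (\<Prod>s<T. P (xs s) (digit_block d k s i) (digit_block d k s j))"

text \<open>Classical post-processing is absorbed into the measurement: effects of sequences with
  the same estimate \<open>p\<close> are added, so the outcome is itself the vector of
  estimates.\<close>

definition block_povm where
  "block_povm d k T X P post p = Matrix.mat (d ^ (T * k)) (d ^ (T * k)) (\<lambda>(i, j).
     \<Sum>xs\<in>{xs \<in> PiE {..<T} (\<lambda>_. X). post xs = p}. block_effect d k T P xs i j)"

text \<open>A product of Gram sums over batches is a Gram sum over one index of the whole system, so
  tensor products of effects stay positive.\<close>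

lemma block_effect_gram:
  assumes d: "0 < d"
    and gram: "\<And>x f g. x \<in> X \<Longrightarrow> f \<in> configs d k \<Longrightarrow> g \<in> configs d k \<Longrightarrow>
       P x f g = (\<Sum>h\<in>configs d k. cnj (P x h f) * P x h g)"
    and xs: "xs \<in> PiE {..<T} (\<lambda>_. X)"
  shows "block_effect d k T P xs i j =
    (\<Sum>l<d ^ (T * k). cnj (block_effect d k T P xs l i) * block_effect d k T P xs l j)"
proof -
  have "block_effect d k T P xs i j = (\<Prod>s<T. \<Sum>h\<in>configs d k.
      cnj (P (xs s) h (digit_block d k s i)) * P (xs s) h (digit_block d k s j))"
    unfolding block_effect_def using xs
    by (intro prod.cong refl gram digit_block_in_configs d) auto
  also have "\<dots> = (\<Sum>l<d ^ (T * k). \<Prod>s<T. cnj (P (xs s) (digit_block d k s l) (digit_block d k s i)) * P (xs s) (digit_block d k s l) (digit_block d k s j))"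
    by (rule sum_blocks[OF d, symmetric])
  finally show ?thesis by (simp add: block_effect_def prod.distrib)
qed

lemma block_povm:
  assumes d: "0 < d" and X: "finite X"
    and res: "\<And>f g. f \<in> configs d k \<Longrightarrow> g \<in> configs d k \<Longrightarrow> (\<Sum>x\<in>X. P x f g) = (if f = g then 1 else 0)"
    and gram: "\<And>x f g. x \<in> X \<Longrightarrow> f \<in> configs d k \<Longrightarrow> g \<in> configs d k \<Longrightarrow>
       P x f g = (\<Sum>h\<in>configs d k. cnj (P x h f) * P x h g)"
  shows "povm (d ^ (T * k)) (post ` PiE {..<T} (\<lambda>_. X)) (block_povm d k T X P post)"
proof -
  let ?N = "d ^ (T * k)" and ?Xs = "PiE {..<T} (\<lambda>_. X)" and ?E = "block_povm d k T X P post"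
  let ?F = "block_effect d k T P"
  have fin: "finite ?Xs" using X by (intro finite_PiE) auto
  have "psd_mat ?N (?E p)" for p
  proof (rule psd_mat_gram)
    let ?L = "{xs \<in> ?Xs. post xs = p} \<times> {..<?N}"
    show "finite ?L" using fin by simp
    show "?E p \<in> carrier_mat ?N ?N" by (simp add: block_povm_def)
    fix i j assume ij: "i < ?N" "j < ?N"
    have "?E p $$ (i, j) = (\<Sum>xs\<in>{xs \<in> ?Xs. post xs = p}. \<Sum>l<?N. cnj (?F xs l i) * ?F xs l j)"
      using ij by (simp add: block_povm_def) (intro sum.cong refl block_effect_gram[OF d gram], auto)
    then show "?E p $$ (i, j) = (\<Sum>l\<in>?L. cnj ((\<lambda>(xs, l) i. ?F xs l i) l i) * (\<lambda>(xs, l) i. ?F xs l i) l j)"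
      by (simp add: sum.cartesian_product case_prod_beta)
  qed
  moreover have "(\<Sum>p\<in>post ` ?Xs. ?E p $$ (i, j)) = (if i = j then 1 else 0)" if ij: "i < ?N" "j < ?N" for i j
  proof -
    have "(\<Sum>p\<in>post ` ?Xs. ?E p $$ (i, j)) = (\<Sum>p\<in>post ` ?Xs. \<Sum>xs\<in>{xs \<in> ?Xs. post xs = p}. ?F xs i j)"
      using ij by (simp add: block_povm_def)
    also have "\<dots> = (\<Sum>xs\<in>?Xs. ?F xs i j)"
      by (rule sum.group) (use fin in auto)
    also have "\<dots> = (\<Prod>s<T. \<Sum>x\<in>X. P x (digit_block d k s i) (digit_block d k s j))"
      unfolding block_effect_def using X
      by (subst prod_sum_PiE) auto
    also have "\<dots> = (\<Prod>s<T. if digit_block d k s i = digit_block d k s j then 1 else 0)"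
      by (intro prod.cong refl res digit_block_in_configs d)
    also have "\<dots> = (if i = j then 1 else 0)"
    proof (cases "i = j")
      case False
      then obtain s where "s < T" "digit_block d k s i \<noteq> digit_block d k s j" using digit_block_inj[OF d ij] by blast
      then have "(\<Prod>s<T. if digit_block d k s i = digit_block d k s j then 1 else (0::complex)) = 0"
        by (intro prod_zero bexI[of _ s]) auto
      with False show ?thesis by simp
    qed simp
    finally show ?thesis .
  qed
  ultimately show ?thesis using fin unfolding povm_def by simp
qed

text \<open>On a product state the weight of an outcome sequence is the product of its batch
  weights, so the batches act as independent trials. The factors are complex here;
  \<open>block_prob_distribution\<close> shows them to be real probabilities.\<close>

lemma block_povm_outcome_prob:
  assumes d: "0 < d" and X: "finite X" and \<rho>: "\<rho> \<in> carrier_mat d d"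
  shows "outcome_prob (post ` PiE {..<T} (\<lambda>_. X)) (block_povm d k T X P post) (tensor_pow \<rho> (T * k)) G =
    Re (\<Sum>xs\<in>{xs \<in> PiE {..<T} (\<lambda>_. X). G (post xs)}. \<Prod>s<T. block_prob d k P \<rho> (xs s))"
proof -
  let ?N = "d ^ (T * k)" and ?Xs = "PiE {..<T} (\<lambda>_. X)" and ?E = "block_povm d k T X P post"
  let ?F = "block_effect d k T P" and ?q = "block_prob d k P \<rho>" and ?\<sigma> = "tensor_pow \<rho> (T * k)"
  let ?S = "{xs \<in> ?Xs. G (post xs)}"
  have fin: "finite ?Xs" using X by (intro finite_PiE) auto
  have "(\<Sum>i<?N. \<Sum>j<?N. ?F xs i j * ?\<sigma> $$ (j, i)) = (\<Prod>s<T. ?q (xs s))" for xs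
  proof -
    have "(\<Sum>i<?N. \<Sum>j<?N. ?F xs i j * ?\<sigma> $$ (j, i)) = (\<Sum>i<?N. \<Sum>j<?N. \<Prod>s<T.
        P (xs s) (digit_block d k s i) (digit_block d k s j) * (\<Prod>t<k. \<rho> $$ (digit_block d k s j t, digit_block d k s i t)))"
      by (intro sum.cong refl) (simp add: block_effect_def tensor_pow_blocks[OF \<rho> d] prod.distrib)
    also have "\<dots> = (\<Sum>i<?N. \<Prod>s<T. \<Sum>g\<in>configs d k.
        P (xs s) (digit_block d k s i) g * (\<Prod>t<k. \<rho> $$ (g t, digit_block d k s i t)))"
      by (rule sum.cong[OF refl], rule sum_blocks[OF d])
    also have "\<dots> = (\<Prod>s<T. \<Sum>f\<in>configs d k. \<Sum>g\<in>configs d k. P (xs s) f g * (\<Prod>t<k. \<rho> $$ (g t, f t)))"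
      by (rule sum_blocks[OF d])
    finally show ?thesis by (simp add: block_prob_def)
  qed
  note tr = this
  have mtr: "mtrace (?E p * ?\<sigma>) = (\<Sum>xs\<in>{xs \<in> ?Xs. post xs = p}. \<Prod>s<T. ?q (xs s))" for p
  proof -
    have "mtrace (?E p * ?\<sigma>) = (\<Sum>i<?N. \<Sum>j<?N. ?E p $$ (i, j) * ?\<sigma> $$ (j, i))"
      by (intro mtrace_mult tensor_pow_carrier \<rho>) (simp add: block_povm_def)
    also have "\<dots> = (\<Sum>i<?N. \<Sum>j<?N. \<Sum>xs\<in>{xs \<in> ?Xs. post xs = p}. ?F xs i j * ?\<sigma> $$ (j, i))"
      by (intro sum.cong refl) (simp add: block_povm_def sum_distrib_right)
    also have "\<dots> = (\<Sum>xs\<in>{xs \<in> ?Xs. post xs = p}. \<Sum>i<?N. \<Sum>j<?N. ?F xs i j * ?\<sigma> $$ (j, i))"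
      by (rule sum_swap3[symmetric])
    finally show ?thesis by (simp only: tr)
  qed
  have "(\<Sum>p\<in>{p \<in> post ` ?Xs. G p}. mtrace (?E p * ?\<sigma>))
      = (\<Sum>p\<in>{p \<in> post ` ?Xs. G p}. \<Sum>xs\<in>{xs \<in> ?S. post xs = p}. \<Prod>s<T. ?q (xs s))"
    unfolding mtr by (intro sum.cong refl arg_cong2[where f = sum]) blast
  also have "\<dots> = (\<Sum>xs\<in>?S. \<Prod>s<T. ?q (xs s))"
    by (rule sum.group) (use fin in auto)
  finally show ?thesis unfolding outcome_prob_def Re_sum[symmetric] by (rule arg_cong)
qed

text \<open>Expanding the product of \<open>k\<close> Gram sums for \<rho> gives Gram vectors that
  are products, indexed by one choice per copy.\<close>

lemma state_gram:
  assumes "psd_mat d \<rho>"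
  obtains W and C :: "(nat \<Rightarrow> (nat \<Rightarrow> real) \<times> nat) \<Rightarrow> (nat \<Rightarrow> nat) \<Rightarrow> complex" where
    "\<And>f g. f \<in> configs d k \<Longrightarrow> g \<in> configs d k \<Longrightarrow> (\<Prod>t<k. \<rho> $$ (g t, f t)) = (\<Sum>w\<in>W. cnj (C w g) * C w f)"
proof -
  obtain W :: "((nat \<Rightarrow> real) \<times> nat) set" and B where W: "finite W" and B: "\<And>a b. a < d \<Longrightarrow> b < d \<Longrightarrow> \<rho> $$ (a, b) = (\<Sum>w\<in>W. cnj (B w a) * B w b)"
    by (rule psd_gram[OF assms]) (rule that; assumption)
  show thesis
  proof (rule that[where W = "PiE {..<k} (\<lambda>_. W)" and C = "\<lambda>w f. \<Prod>t<k. B (w t) (f t)"])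
    fix f g assume fg: "f \<in> configs d k" "g \<in> configs d k"
    have "(\<Prod>t<k. \<rho> $$ (g t, f t)) = (\<Prod>t<k. \<Sum>w\<in>W. cnj (B w (g t)) * B w (f t))"
      using fg by (intro prod.cong refl B) (auto simp: configs_def)
    also have "\<dots> = (\<Sum>w\<in>PiE {..<k} (\<lambda>_. W). \<Prod>t<k. cnj (B (w t) (g t)) * B (w t) (f t))"
      using W by (intro prod_sum_PiE) auto
    finally show "(\<Prod>t<k. \<rho> $$ (g t, f t)) =
      (\<Sum>w\<in>PiE {..<k} (\<lambda>_. W). cnj (\<Prod>t<k. B (w t) (g t)) * (\<Prod>t<k. B (w t) (f t)))"
      by (simp add: prod.distrib)
  qed
qed

lemma block_prob_distribution:
  assumes psd: "psd_mat d \<rho>" and tr: "(\<Sum>a<d. \<rho> $$ (a, a)) = 1"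
    and res: "\<And>f g. f \<in> configs d k \<Longrightarrow> g \<in> configs d k \<Longrightarrow> (\<Sum>x\<in>X. P x f g) = (if f = g then 1 else 0)"
    and gram: "\<And>x f g. x \<in> X \<Longrightarrow> f \<in> configs d k \<Longrightarrow> g \<in> configs d k \<Longrightarrow>
       P x f g = (\<Sum>h\<in>configs d k. cnj (P x h f) * P x h g)"
  shows "x \<in> X \<Longrightarrow> block_prob d k P \<rho> x = complex_of_real (Re (block_prob d k P \<rho> x))"
    and "x \<in> X \<Longrightarrow> 0 \<le> Re (block_prob d k P \<rho> x)"
    and "(\<Sum>x\<in>X. block_prob d k P \<rho> x) = 1"
proof -
  obtain W and C :: "(nat \<Rightarrow> (nat \<Rightarrow> real) \<times> nat) \<Rightarrow> (nat \<Rightarrow> nat) \<Rightarrow> complex" where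
    WC: "\<And>f g. f \<in> configs d k \<Longrightarrow> g \<in> configs d k \<Longrightarrow> (\<Prod>t<k. \<rho> $$ (g t, f t)) = (\<Sum>w\<in>W. cnj (C w g) * C w f)"
    by (rule state_gram[OF psd, of k]) (rule that; assumption)
  show "block_prob d k P \<rho> x = complex_of_real (Re (block_prob d k P \<rho> x))" if "x \<in> X"
    unfolding block_prob_def
    by (rule of_real_Re[symmetric], rule gram_pairing_nonneg(1)[OF gram[OF that] WC])
  show "0 \<le> Re (block_prob d k P \<rho> x)" if "x \<in> X"
    unfolding block_prob_def by (rule gram_pairing_nonneg(2)[OF gram[OF that] WC])
  have "(\<Sum>x\<in>X. block_prob d k P \<rho> x)
      = (\<Sum>f\<in>configs d k. \<Sum>g\<in>configs d k. (\<Sum>x\<in>X. P x f g) * (\<Prod>t<k. \<rho> $$ (g t, f t)))"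
    unfolding block_prob_def sum_distrib_right by (rule sum_swap3)
  also have "\<dots> = (\<Sum>f\<in>configs d k. \<Sum>g\<in>configs d k. if f = g then \<Prod>t<k. \<rho> $$ (g t, f t) else 0)"
    by (intro sum.cong refl) (simp add: res)
  also have "\<dots> = (\<Sum>f\<in>configs d k. \<Prod>t<k. \<rho> $$ (f t, f t))"
    by (intro sum.cong refl) simp
  also have "\<dots> = 1" by (simp add: sum_configs_prod[of "\<lambda>t a. \<rho> $$ (a, a)"] tr)
  finally show "(\<Sum>x\<in>X. block_prob d k P \<rho> x) = 1" .
qed

section \<open>The estimator\<close>

lemma density_mat_carrier: "density_mat d \<rho> \<Longrightarrow> \<rho> \<in> carrier_mat d d"
  unfolding density_mat_def psd_mat_def hermitian_mat_def by (elim conjE)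

lemma density_mat_trace: "density_mat d \<rho> \<Longrightarrow> (\<Sum>a<d. \<rho> $$ (a, a)) = 1"
  using carrier_matD(1)[OF density_mat_carrier, of d \<rho>]
  unfolding density_mat_def mtrace_def by (simp only: simp_thms)

lemma density_mat_dim_pos: "density_mat d \<rho> \<Longrightarrow> 0 < d"
  using density_mat_trace[of d \<rho>] by (cases d) auto

text \<open>The moment is the mean of real outcomes under the batch distribution, hence
  real.\<close>

lemma moment_block_prob:
  assumes \<rho>: "density_mat d \<rho>" and j: "0 < j" "j \<le> k"
    and res: "\<And>f g. f \<in> configs d k \<Longrightarrow> g \<in> configs d k \<Longrightarrow> (\<Sum>x\<in>X. P x f g) = (if f = g then 1 else 0)"
    and gram: "\<And>x f g. x \<in> X \<Longrightarrow> f \<in> configs d k \<Longrightarrow> g \<in> configs d k \<Longrightarrow>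
       P x f g = (\<Sum>h\<in>configs d k. cnj (P x h f) * P x h g)"
    and mom: "\<And>\<rho> j. \<rho> \<in> carrier_mat d d \<Longrightarrow> (\<Sum>a<d. \<rho> $$ (a, a)) = 1 \<Longrightarrow> 0 < j \<Longrightarrow> j \<le> k \<Longrightarrow>
       (\<Sum>x\<in>X. complex_of_real (x j) * block_prob d k P \<rho> x) = mtrace (Q * \<rho> ^\<^sub>m j)"
  shows "mtrace (Q * \<rho> ^\<^sub>m j) = complex_of_real (\<Sum>x\<in>X. Re (block_prob d k P \<rho> x) * x j)"
proof -
  have psd: "psd_mat d \<rho>" and c: "\<rho> \<in> carrier_mat d d"
    using \<rho> density_mat_carrier by (simp_all only: density_mat_def)
  note dist = block_prob_distribution[where X = X, OF psd density_mat_trace[OF \<rho>] res gram]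
  have "mtrace (Q * \<rho> ^\<^sub>m j) = (\<Sum>x\<in>X. complex_of_real (x j) * block_prob d k P \<rho> x)"
    by (rule mom[OF c density_mat_trace[OF \<rho>] j, symmetric])
  also have "\<dots> = (\<Sum>x\<in>X. complex_of_real (Re (block_prob d k P \<rho> x) * x j))"
  proof (rule sum.cong[OF refl])
    fix x assume "x \<in> X"
    then have "block_prob d k P \<rho> x = complex_of_real (Re (block_prob d k P \<rho> x))" by (rule dist(1)[rotated -1])
    then obtain r where "block_prob d k P \<rho> x = complex_of_real r" by blast
    then show "complex_of_real (x j) * block_prob d k P \<rho> x = complex_of_real (Re (block_prob d k P \<rho> x) * x j)"
      by simp
  qed
  finally show ?thesis by simp
qed

text \<open>Rules out dimension zero when the norm exceeds a positive \<epsilon>, the case in which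
  a genuine measurement is made.\<close>

lemma op_norm_dim_0: "op_norm 0 Q \<le> 0"
proof -
  have "cvec_norm (Q *\<^sub>v v) = 0" if "v \<in> carrier_vec 0" for v
    using that by (simp add: cvec_norm_def scalar_prod_def mult_mat_vec_def)
  moreover have "0\<^sub>v 0 \<in> carrier_vec 0" "cvec_norm (0\<^sub>v 0) \<le> 1" by (simp_all add: cvec_norm_def)
  ultimately show ?thesis unfolding op_norm_def
    by (intro cSup_least) (blast, force)
qed

text \<open>The factor 8 makes the Hoeffding exponent at least \<open>4 * ln k\<close>, so the total
  failure is at most \<open>2 / k ^ 3 \<le> 1 / 4\<close>. Rounding up costs at most 1, which is at
  most \<open>2 * (M\<^sup>2 / \<epsilon>\<^sup>2) * ln k\<close> because
  \<open>\<epsilon> < M\<close> and \<open>ln k \<ge> 1 / 2\<close>; hence 10 instead of 8.\<close>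

lemma sample_count:
  fixes M \<epsilon> :: real and k :: nat
  assumes "2 \<le> k" "0 < \<epsilon>" "\<epsilon> < M"
  defines "T \<equiv> nat \<lceil>8 * (M\<^sup>2 / \<epsilon>\<^sup>2) * ln k\<rceil>"
  shows "real (T * k) \<le> 10 * real k * ln (real k) * M\<^sup>2 / \<epsilon>\<^sup>2"
    and "0 < T"
    and "real k * (2 * exp (- (real T * \<epsilon>\<^sup>2 / (2 * M\<^sup>2)))) \<le> 1 / 3"
proof -
  define r where "r = M\<^sup>2 / \<epsilon>\<^sup>2"
  have r: "1 \<le> r" using assms by (simp add: r_def power_mono)
  have "ln 2 \<le> ln (real k)" using assms by simp
  then have lnk: "1 / 2 \<le> ln (real k)" using ln2_ge_two_thirds by linarith
  have rl: "1 / 2 \<le> r * ln k" using r lnk mult_mono[of 1 r "1/2" "ln k"] by simp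
  have T_ge: "8 * r * ln k \<le> real T" unfolding T_def r_def by linarith
  have T_le: "real T \<le> 8 * r * ln k + 1" unfolding T_def r_def[symmetric] using rl by linarith
  then have "real T \<le> 10 * (r * ln k)" using rl by linarith
  then have "real T * real k \<le> 10 * (r * ln k) * real k" by (intro mult_right_mono) auto
  then show "real (T * k) \<le> 10 * real k * ln (real k) * M\<^sup>2 / \<epsilon>\<^sup>2"
    by (simp add: r_def mult_ac)
  show "0 < T" using T_ge rl by (cases T) auto
  have "4 * ln k = (8 * r * ln k) * \<epsilon>\<^sup>2 / (2 * M\<^sup>2)"
    using assms by (simp add: r_def)
  also have "\<dots> \<le> real T * \<epsilon>\<^sup>2 / (2 * M\<^sup>2)"
    using T_ge by (intro divide_right_mono mult_right_mono) auto
  finally have "exp (- (real T * \<epsilon>\<^sup>2 / (2 * M\<^sup>2))) \<le> exp (- (4 * ln k))" by simp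
  also have "\<dots> = 1 / real k ^ 4"
    using assms exp_of_nat_mult[of 4 "ln (real k)"] by (simp add: exp_minus inverse_eq_divide)
  finally have "real k * (2 * exp (- (real T * \<epsilon>\<^sup>2 / (2 * M\<^sup>2)))) \<le> real k * (2 * (1 / real k ^ 4))"
    by (intro mult_left_mono) auto
  also have "\<dots> = 2 / real k ^ 3" using assms by (simp add: power_numeral_reduce)
  also have "\<dots> \<le> 2 / 2 ^ 3" using assms by (intro divide_left_mono power_mono) auto
  finally show "real k * (2 * exp (- (real T * \<epsilon>\<^sup>2 / (2 * M\<^sup>2)))) \<le> 1 / 3" by simp
qed

text \<open>The moment is the mean of measurement outcomes bounded by the operator norm; this
  replaces a separate trace-norm inequality.\<close>

lemma trivial_estimator:
  assumes Q: "hermitian_mat d Q" and k: "0 < k" and le: "op_norm d Q \<le> \<epsilon>" and \<rho>: "density_mat d \<rho>"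
    and j: "j \<in> {1..k}"
  shows "cmod (mtrace (Q * \<rho> ^\<^sub>m j)) \<le> \<epsilon>"
proof -
  have d: "0 < d" using \<rho> by (rule density_mat_dim_pos)
  have psd: "psd_mat d \<rho>" using \<rho> by (simp add: density_mat_def)
  obtain X :: "(nat \<Rightarrow> real) set" and P where
    bnd: "\<And>x j. x \<in> X \<Longrightarrow> j \<le> k \<Longrightarrow> \<bar>x j\<bar> \<le> op_norm d Q" and
    res: "\<And>f g. f \<in> configs d k \<Longrightarrow> g \<in> configs d k \<Longrightarrow> (\<Sum>x\<in>X. P x f g) = (if f = g then 1 else 0)" and
    gram: "\<And>x f g. x \<in> X \<Longrightarrow> f \<in> configs d k \<Longrightarrow> g \<in> configs d k \<Longrightarrow>
       P x f g = (\<Sum>h\<in>configs d k. cnj (P x h f) * P x h g)" and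
    mom: "\<And>\<rho> j. \<rho> \<in> carrier_mat d d \<Longrightarrow> (\<Sum>a<d. \<rho> $$ (a, a)) = 1 \<Longrightarrow> 0 < j \<Longrightarrow> j \<le> k \<Longrightarrow>
       (\<Sum>x\<in>X. complex_of_real (x j) * block_prob d k P \<rho> x) = mtrace (Q * \<rho> ^\<^sub>m j)"
    by (rule shift_measurement[OF Q k d]) (rule that; assumption)
  let ?q = "\<lambda>x. Re (block_prob d k P \<rho> x)"
  note dist = block_prob_distribution[where X = X, OF psd density_mat_trace[OF \<rho>] res gram]
  have "mtrace (Q * \<rho> ^\<^sub>m j) = complex_of_real (\<Sum>x\<in>X. ?q x * x j)"
    by (rule moment_block_prob[OF \<rho> _ _ res gram mom]) (use j in auto)
  then have "cmod (mtrace (Q * \<rho> ^\<^sub>m j)) = \<bar>\<Sum>x\<in>X. ?q x * x j\<bar>" by (simp only: norm_of_real)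
  also have "\<dots> \<le> (\<Sum>x\<in>X. \<bar>?q x * x j\<bar>)" by (rule sum_abs)
  also have "\<dots> \<le> (\<Sum>x\<in>X. ?q x * op_norm d Q)"
    using dist(2) bnd j by (intro sum_mono) (auto simp: abs_mult intro!: mult_left_mono)
  also have "\<dots> = Re (\<Sum>x\<in>X. block_prob d k P \<rho> x) * op_norm d Q"
    by (simp add: sum_distrib_right)
  also have "\<dots> = op_norm d Q" by (simp add: dist(3))
  finally show ?thesis using le by simp
qed

theorem theorem3p1:
  "\<exists>C::real. C > 0 \<and>
    (\<forall>(d::nat) (Obs::complex mat) (k::nat) (\<epsilon>::real).
       hermitian_mat d Obs \<longrightarrow> k \<ge> 2 \<longrightarrow> \<epsilon> > 0 \<longrightarrow>
       (\<exists>(m::nat) (X::(nat \<Rightarrow> real) set) (E::(nat \<Rightarrow> real) \<Rightarrow> complex mat).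
          real m \<le> C * real k * ln (real k) * (op_norm d Obs)\<^sup>2 / \<epsilon>\<^sup>2 \<and>
          povm (d ^ m) X E \<and>
          (\<forall>\<rho>. density_mat d \<rho> \<longrightarrow>
             outcome_prob X E (tensor_pow \<rho> m)
               (\<lambda>p. \<forall>j\<in>{1..k}. cmod (complex_of_real (p j) - mtrace (Obs * (\<rho> ^\<^sub>m j))) \<le> \<epsilon>)
             \<ge> 2/3)))"
proof (rule exI[of _ 10], intro conjI allI impI)
  fix d k :: nat and Obs :: "complex mat" and \<epsilon> :: real
  assume herm: "hermitian_mat d Obs" and k: "2 \<le> k" and \<epsilon>: "0 < \<epsilon>"
  let ?M = "op_norm d Obs"
  let ?good = "\<lambda>\<rho> p. \<forall>j\<in>{1..k}. cmod (complex_of_real (p j) - mtrace (Obs * (\<rho> ^\<^sub>m j))) \<le> \<epsilon>"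
  have k0: "0 < k" using k by simp
  show "\<exists>m (X::(nat \<Rightarrow> real) set) E.
          real m \<le> 10 * real k * ln (real k) * ?M\<^sup>2 / \<epsilon>\<^sup>2 \<and> povm (d ^ m) X E \<and>
          (\<forall>\<rho>. density_mat d \<rho> \<longrightarrow> 2/3 \<le> outcome_prob X E (tensor_pow \<rho> m) (?good \<rho>))"
  proof (cases "?M \<le> \<epsilon>")
    case True
    \<comment> \<open>With no copies the system has dimension \<open>d ^ 0 = 1\<close>, also for
      \<open>d = 0\<close>, and the only outcome is the zero vector of estimates.\<close>
    let ?X = "{\<lambda>_. 0} :: (nat \<Rightarrow> real) set" and ?E = "\<lambda>_. 1\<^sub>m 1 :: complex mat"
    have "psd_mat 1 (1\<^sub>m 1 :: complex mat)"
      by (rule psd_mat_gram[of "{()}" _ _ "\<lambda>_ _. 1"]) auto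
    then have "povm (d ^ 0) ?X ?E" by (simp add: povm_def)
    moreover have "2/3 \<le> outcome_prob ?X ?E (tensor_pow \<rho> 0) (?good \<rho>)" if "density_mat d \<rho>" for \<rho>
    proof -
      have "?good \<rho> (\<lambda>_. 0)" using trivial_estimator[OF herm k0 True that] by simp
      then have "{p \<in> ?X. ?good \<rho> p} = ?X" by auto
      then show ?thesis by (simp add: outcome_prob_def mtrace_def)
    qed
    moreover have "real 0 \<le> 10 * real k * ln (real k) * ?M\<^sup>2 / \<epsilon>\<^sup>2" using k by simp
    ultimately show ?thesis by blast
  next
    case False
    then have M: "\<epsilon> < ?M" by simp
    then have d: "0 < d" using op_norm_dim_0[of Obs] \<epsilon> by (cases d) auto
    obtain X :: "(nat \<Rightarrow> real) set" and P where
      X: "finite X" and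
      bnd: "\<And>x j. x \<in> X \<Longrightarrow> j \<le> k \<Longrightarrow> \<bar>x j\<bar> \<le> ?M" and
      res: "\<And>f g. f \<in> configs d k \<Longrightarrow> g \<in> configs d k \<Longrightarrow> (\<Sum>x\<in>X. P x f g) = (if f = g then 1 else 0)" and
      gram: "\<And>x f g. x \<in> X \<Longrightarrow> f \<in> configs d k \<Longrightarrow> g \<in> configs d k \<Longrightarrow>
         P x f g = (\<Sum>h\<in>configs d k. cnj (P x h f) * P x h g)" and
      mom: "\<And>\<rho> j. \<rho> \<in> carrier_mat d d \<Longrightarrow> (\<Sum>a<d. \<rho> $$ (a, a)) = 1 \<Longrightarrow> 0 < j \<Longrightarrow> j \<le> k \<Longrightarrow>
         (\<Sum>x\<in>X. complex_of_real (x j) * block_prob d k P \<rho> x) = mtrace (Obs * \<rho> ^\<^sub>m j)"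
      by (rule shift_measurement[OF herm k0 d]) (rule that; assumption)
    define T where "T = nat \<lceil>8 * (?M\<^sup>2 / \<epsilon>\<^sup>2) * ln k\<rceil>"
    note count = sample_count[OF k \<epsilon> M, folded T_def]
    define avg :: "(nat \<Rightarrow> nat \<Rightarrow> real) \<Rightarrow> nat \<Rightarrow> real" where "avg = (\<lambda>xs j. (\<Sum>s<T. xs s j) / real T)"
    let ?Xs = "PiE {..<T} (\<lambda>_. X)"
    let ?E = "block_povm d k T X P avg"
    have "2/3 \<le> outcome_prob (avg ` ?Xs) ?E (tensor_pow \<rho> (T * k)) (?good \<rho>)" if \<rho>: "density_mat d \<rho>" for \<rho>
    proof -
      have psd: "psd_mat d \<rho>" and c: "\<rho> \<in> carrier_mat d d"
        using \<rho> density_mat_carrier by (simp_all only: density_mat_def)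
      note dist = block_prob_distribution[where X = X, OF psd density_mat_trace[OF \<rho>] res gram]
      define q where "q = (\<lambda>x. Re (block_prob d k P \<rho> x))"
      define \<mu> where "\<mu> = (\<lambda>j. \<Sum>x\<in>X. q x * x j)"
      have \<mu>: "mtrace (Obs * \<rho> ^\<^sub>m j) = complex_of_real (\<mu> j)" if "j \<in> {1..k}" for j
        unfolding \<mu>_def q_def by (rule moment_block_prob[OF \<rho> _ _ res gram mom]) (use that in auto)
      \<comment> \<open>All moments are real, so the complex distance is an absolute value and the
        real concentration bound applies.\<close>
      have good: "?good \<rho> p \<longleftrightarrow> (\<forall>j\<in>{1..k}. \<bar>p j - \<mu> j\<bar> \<le> \<epsilon>)" for p
        by (intro ball_cong refl) (simp only: \<mu> of_real_diff[symmetric] norm_of_real)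
      have "(\<Sum>x\<in>X. block_prob d k P \<rho> x) = 1" by (rule dist(3))
      then have q1: "(\<Sum>x\<in>X. q x) = 1" unfolding q_def Re_sum[symmetric] by simp
      have "2/3 \<le> 1 - card {1..k} * (2 * exp (- (real T * \<epsilon>\<^sup>2 / (2 * ?M\<^sup>2))))"
        using count(3) by simp
      also have "\<dots> \<le> (\<Sum>xs\<in>{xs \<in> ?Xs. \<forall>j\<in>{1..k}. \<bar>(\<Sum>s<T. xs s j) / real T - (\<Sum>x\<in>X. q x * x j)\<bar> \<le> \<epsilon>}.
          \<Prod>s<T. q (xs s))"
        by (rule iid_mean_concentration[where y = "\<lambda>j x. x j", OF X _ q1])
           (use dist(2) bnd M \<epsilon> count(2) in \<open>auto simp: q_def\<close>)
      also have "\<dots> = (\<Sum>xs\<in>{xs \<in> ?Xs. ?good \<rho> (avg xs)}. \<Prod>s<T. q (xs s))"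
        unfolding good avg_def \<mu>_def ..
      also have "\<dots> = Re (\<Sum>xs\<in>{xs \<in> ?Xs. ?good \<rho> (avg xs)}. \<Prod>s<T. block_prob d k P \<rho> (xs s))"
        unfolding Re_sum
      proof (intro sum.cong refl)
        fix xs assume "xs \<in> {xs \<in> ?Xs. ?good \<rho> (avg xs)}"
        then have "block_prob d k P \<rho> (xs s) = complex_of_real (q (xs s))" if "s < T" for s
          unfolding q_def using that by (intro dist(1)) auto
        then have "(\<Prod>s<T. block_prob d k P \<rho> (xs s)) = complex_of_real (\<Prod>s<T. q (xs s))"
          by simp
        then show "(\<Prod>s<T. q (xs s)) = Re (\<Prod>s<T. block_prob d k P \<rho> (xs s))"
          by (simp only: Re_complex_of_real)
      qed
      also have "\<dots> = outcome_prob (avg ` ?Xs) ?E (tensor_pow \<rho> (T * k)) (?good \<rho>)"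
        by (rule block_povm_outcome_prob[OF d X c, symmetric])
      finally show ?thesis .
    qed
    moreover have "povm (d ^ (T * k)) (avg ` ?Xs) ?E" by (rule block_povm[OF d X res gram])
    ultimately show ?thesis using count(1) by blast
  qed
qed simp

end
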